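(* Let $\mathbf p$ be given controller parameters, let $[a,b]\subset\mathbb R$, and assume that the parametrized subsystem (S) of the context is exponentially stable for all $\lambda\in[a,b]$. With (N), $T(\cdot;\mathbf p,N)$ and $\|\hat T_{\hat w\hat z}(\cdot;\mathbf p,\cdot)\|_{\mathcal H_\infty}^{[a,b]}$ as in the context: (1) If $P_N\in\mathbb R^{N\times N}$ has real eigenvalues contained in $[a,b]$ and is diagonalizable by a unitary matrix, then $$\|T(\cdot;\mathbf p,N)\|_{\mathcal H_\infty}\le\|\hat T_{\hat w\hat z}(\cdot;\mathbf p,\cdot)\|_{\mathcal H_\infty}^{[a,b]}.$$ (2) If $(P_N)_{N\ge 1}$ is a family of adjacency matrices, $P_N\in\mathbb R^{N\times N}$, such that for every $N$ the matrix $P_N$ is diagonalizable by a unitary matrix and has real eigenvalues contained in $[a,b]$, with $a$ and $b$ independent of $N$, then $$\sup_{N=1,\dots,+\infty}\|T(\cdot;\mathbf p,N)\|_{\mathcal H_\infty}\le\|\hat T_{\hat w\hat z}(\cdot;\mathbf p,\cdot)\|_{\mathcal H_\infty}^{[a,b]}.$$ (3) If, in addition to the hypotheses of (2), the Hausdorff distance between $[a,b]$ and $\bigcup_{N=1}^{+\infty}\{\lambda\in\mathbb C:\det(I_N\lambda-P_N)=0\}$ is zero, then $$\sup_{N=1,\dots,+\infty}\|T(\cdot;\mathbf p,N)\|_{\mathcal H_\infty}=\|\hat T_{\hat w\hat z}(\cdot;\mathbf p,\cdot)\|_{\mathcal H_\infty}^{[a,b]}.$$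
   Context: Data. $0=\tau_0<\tau_1<\dots<\tau_K$ and $\tau_u,\tau_n,\tau_{nc}\ge 0$ are delays. $A_k\in\mathbb R^{n\times n}$ ($k=0,\dots,K$), $B_u\in\mathbb R^{n\times m_c}$, $B_{u_n}\in\mathbb R^{n\times q}$, $B_w\in\mathbb R^{n\times m}$, $C_y\in\mathbb R^{p_c\times n}$, $C_{y_n}\in\mathbb R^{q\times n}$, $C_z\in\mathbb R^{p\times n}$ are real matrices. For controller parameters $\mathbf p$, the controller matrices $J_{\mathbf p}\in\mathbb R^{n_c\times n_c}$, $F_{\mathbf p},F^n_{\mathbf p}\in\mathbb R^{n_c\times p_c}$, $L_{\mathbf p}\in\mathbb R^{m_c\times n_c}$, $K_{\mathbf p},K^n_{\mathbf p}\in\mathbb R^{m_c\times p_c}$ are real. All these data are independent of $N$. Networked system (N) with $N$ subsystems and adjacency matrix $P_N$, with $x(t)\in\mathbb R^{Nn}$, $\xi(t)\in\mathbb R^{Nn_c}$, $w(t)\in\mathbb R^{Nm}$, $z(t)\in\mathbb R^{Np}$: $$\begin{aligned}\dot x(t)=&\sum_{k=0}^K(I_N\otimes A_k)x(t-\tau_k)+(I_N\otimes B_uK_{\mathbf p}C_y)x(t-\tau_u)+(P_N\otimes B_{u_n}C_{y_n})x(t-\tau_n)\\ &+(I_N\otimes B_uL_{\mathbf p})\xi(t-\tau_u)+(P_N\otimes B_uK^n_{\mathbf p}C_y)x(t-\tau_u-\tau_{nc})+(I_N\otimes B_w)w(t),\\ \dot\xi(t)=&(I_N\otimes J_{\mathbf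 p})\xi(t)+(I_N\otimes F_{\mathbf p}C_y)x(t)+(P_N\otimes F^n_{\mathbf p}C_y)x(t-\tau_{nc}),\\ z(t)=&(I_N\otimes C_z)x(t).\end{aligned}$$ Transfer functions. Put $$Q_{\mathbf p}(s)=\begin{bmatrix}A_0&0\\ F_{\mathbf p}C_y&J_{\mathbf p}\end{bmatrix}+\sum_{k=1}^K\begin{bmatrix}A_k&0\\ 0&0\end{bmatrix}e^{-s\tau_k}+\begin{bmatrix}B_uK_{\mathbf p}C_y&B_uL_{\mathbf p}\\ 0&0\end{bmatrix}e^{-s\tau_u},$$ $$R_{\mathbf p}(s)=\begin{bmatrix}B_{u_n}C_{y_n}&0\\ 0&0\end{bmatrix}e^{-s\tau_n}+\begin{bmatrix}B_uK^n_{\mathbf p}C_y&0\\ 0&0\end{bmatrix}e^{-s(\tau_u+\tau_{nc})}+\begin{bmatrix}0&0\\ F^n_{\mathbf p}C_y&0\end{bmatrix}e^{-s\tau_{nc}}.$$ The transfer function of (N) from $w$ to $z$ is $$T(s;\mathbf p,N)=(I_N\otimes[C_z\ \ 0])\big(I_{N(n+n_c)}s-I_N\otimes Q_{\mathbf p}(s)-P_N\otimes R_{\mathbf p}(s)\big)^{-1}\Big(I_N\otimes\begin{bmatrix}B_w\\ 0\end{bmatrix}\Big).$$ Parametrized subsystem (S), with $\hat x(t)$ of dimension $n$, $\hat\xi(t)$ of dimension $n_c$, and parameter $\lambda\in\mathbb R$: $$\begin{aligned}\dot{\hat x}(t)=&\sum_{k=0}^KA_k\hat x(t-\tau_k)+B_uK_{\mathbf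 p}C_y\hat x(t-\tau_u)+\lambda B_{u_n}C_{y_n}\hat x(t-\tau_n)\\ &+\lambda B_uK^n_{\mathbf p}C_y\hat x(t-\tau_u-\tau_{nc})+B_uL_{\mathbf p}\hat\xi(t-\tau_u)+B_w\hat w(t),\\ \dot{\hat\xi}(t)=&J_{\mathbf p}\hat\xi(t)+F_{\mathbf p}C_y\hat x(t)+\lambda F^n_{\mathbf p}C_y\hat x(t-\tau_{nc}),\qquad \hat z(t)=C_z\hat x(t).\end{aligned}$$ Its transfer function from $\hat w$ to $\hat z$ is $\hat T_{\hat w\hat z}(s;\mathbf p,\lambda)=[C_z\ \ 0]\,(I_{n+n_c}s-Q_{\mathbf p}(s)-\lambda R_{\mathbf p}(s))^{-1}\begin{bmatrix}B_w\\ 0\end{bmatrix}$. Exponential stability means that the zero solution of the system with zero input is exponentially stable. For an exponentially stable system with transfer function $G$, $\|G\|_{\mathcal H_\infty}=\max_{\omega\in\mathbb R^+}\sigma_1(G(\jmath\omega))$, where $\sigma_1$ is the largest singular value, $\mathbb R^+=[0,\infty)$ and $\jmath$ is the imaginary unit. The robust $\mathcal H_\infty$-norm is $$\|\hat T_{\hat w\hat z}(\cdot;\mathbf p,\cdot)\|_{\mathcal H_\infty}^{[a,b]}=\max_{\lambda\in[a,b]}\|\hat T_{\hat w\hat z}(\cdot;\mathbf p,\lambda)\|_{\mathcal H_\infty}.$$ If all eigenvalues of a unitarily diagonalizable $P_N$ lie in $[a,b]$, exponential stability of (S) for all $\lambda\in[a,b]$ implies exponential stability of (N). *)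

theory Defs
  imports
    "HOL-Analysis.Elementary_Metric_Spaces"
    "HOL-Library.Extended_Real"
    "Jordan_Normal_Form.Gauss_Jordan_Elimination"
    "Jordan_Normal_Form.Schur_Decomposition"
    "Jordan_Normal_Form.Spectral_Radius"
begin

abbreviation cmat :: "real mat \<Rightarrow> complex mat" where
  "cmat \<equiv> map_mat complex_of_real"

definition kron :: "'a::semiring_0 mat \<Rightarrow> 'a mat \<Rightarrow> 'a mat" (infixl \<open>\<otimes>\<^sub>k\<close> 75) where
  "A \<otimes>\<^sub>k B = mat (dim_row A * dim_row B) (dim_col A * dim_col B)
     (\<lambda>(i, j). A $$ (i div dim_row B, j div dim_col B) * B $$ (i mod dim_row B, j mod dim_col B))"

definition mat_sum :: "nat \<Rightarrow> nat \<Rightarrow> ('i \<Rightarrow> 'a::comm_monoid_add mat) \<Rightarrow> 'i set \<Rightarrow> 'a mat" where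
  "mat_sum r c f I = mat r c (\<lambda>ij. \<Sum>k\<in>I. f k $$ ij)"

definition vec_sum :: "nat \<Rightarrow> ('i \<Rightarrow> 'a::comm_monoid_add vec) \<Rightarrow> 'i set \<Rightarrow> 'a vec" where
  "vec_sum d f I = vec d (\<lambda>i. \<Sum>k\<in>I. f k $ i)"

text \<open>Only meaningful for invertible matrices; otherwise the value is unspecified.\<close>

definition mat_inv :: "'a::field mat \<Rightarrow> 'a mat" where
  "mat_inv M = the (mat_inverse M)"

definition euclid_norm :: "real vec \<Rightarrow> real" where
  "euclid_norm v = sqrt (scalar_prod v v)"

text \<open>\<open>similar_mat_wit M D U V\<close> contains \<open>U * V = 1 = V * U\<close>, so \<open>U\<close> below is unitary.\<close>

definition unitarily_diagonalizable :: "complex mat \<Rightarrow> bool" where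
  "unitarily_diagonalizable M \<longleftrightarrow>
     (\<exists>U D. diagonal_mat D \<and> similar_mat_wit M D U (mat_adjoint U))"

definition singular_values :: "complex mat \<Rightarrow> real set" where
  "singular_values M = {sqrt \<mu> | \<mu>. \<mu> \<ge> 0 \<and> eigenvalue (mat_adjoint M * M) (complex_of_real \<mu>)}"

definition sigma1 :: "complex mat \<Rightarrow> real" where
  "sigma1 M = Max (singular_values M)"

text \<open>Only meaningful for nonempty sets, since \<open>infdist x {} = 0\<close>.\<close>

definition hausdorff_dist :: "'a::metric_space set \<Rightarrow> 'a set \<Rightarrow> ereal" where
  "hausdorff_dist X Y =
     max (SUP x\<in>X. ereal (infdist x Y)) (SUP y\<in>Y. ereal (infdist y X))"

text \<open>
  The plant matrices, the delays and the dimensions are fixed; the controller matrices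
  depend on the controller parameters, which range over the type \<open>'p\<close>.
  The dimensions are \<open>n\<close> (\<open>dim_x\<close>), \<open>n_c\<close> (\<open>dim_xi\<close>),
  \<open>m_c\<close> (\<open>dim_u\<close>), \<open>p_c\<close> (\<open>dim_y\<close>),
  \<open>q\<close> (\<open>dim_nw\<close>), \<open>m\<close> (\<open>dim_w\<close>) and
  \<open>p\<close> (\<open>dim_z\<close>); there are \<open>num_delays + 1\<close> state delays.
\<close>

record 'p network_data =
  dim_x :: nat
  dim_xi :: nat
  dim_u :: nat
  dim_y :: nat
  dim_nw :: nat
  dim_w :: nat
  dim_z :: nat
  num_delays :: nat
  tau :: "nat \<Rightarrow> real"
  tau_u :: real
  tau_n :: real
  tau_nc :: real
  mat_A :: "nat \<Rightarrow> real mat"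
  mat_Bu :: "real mat"
  mat_Bun :: "real mat"
  mat_Bw :: "real mat"
  mat_Cy :: "real mat"
  mat_Cyn :: "real mat"
  mat_Cz :: "real mat"
  mat_J :: "'p \<Rightarrow> real mat"
  mat_F :: "'p \<Rightarrow> real mat"
  mat_Fn :: "'p \<Rightarrow> real mat"
  mat_L :: "'p \<Rightarrow> real mat"
  mat_K :: "'p \<Rightarrow> real mat"
  mat_Kn :: "'p \<Rightarrow> real mat"

text \<open>
  The input dimension has to be positive for a largest singular value to exist (a matrix
  without columns has no singular values in the sense above).  The other dimensions may
  be zero, so that, for example, static controllers are included.
\<close>

definition wf_data :: "'p network_data \<Rightarrow> 'p \<Rightarrow> bool" where
  "wf_data S p \<longleftrightarrow>
     dim_w S \<ge> 1 \<and>
     tau S 0 = 0 \<and> (\<forall>k < num_delays S. tau S k < tau S (Suc k)) \<and>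
     tau_u S \<ge> 0 \<and> tau_n S \<ge> 0 \<and> tau_nc S \<ge> 0 \<and>
     (\<forall>k \<le> num_delays S. mat_A S k \<in> carrier_mat (dim_x S) (dim_x S)) \<and>
     mat_Bu S \<in> carrier_mat (dim_x S) (dim_u S) \<and>
     mat_Bun S \<in> carrier_mat (dim_x S) (dim_nw S) \<and>
     mat_Bw S \<in> carrier_mat (dim_x S) (dim_w S) \<and>
     mat_Cy S \<in> carrier_mat (dim_y S) (dim_x S) \<and>
     mat_Cyn S \<in> carrier_mat (dim_nw S) (dim_x S) \<and>
     mat_Cz S \<in> carrier_mat (dim_z S) (dim_x S) \<and>
     mat_J S p \<in> carrier_mat (dim_xi S) (dim_xi S) \<and>
     mat_F S p \<in> carrier_mat (dim_xi S) (dim_y S) \<and>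
     mat_Fn S p \<in> carrier_mat (dim_xi S) (dim_y S) \<and>
     mat_L S p \<in> carrier_mat (dim_u S) (dim_xi S) \<and>
     mat_K S p \<in> carrier_mat (dim_u S) (dim_y S) \<and>
     mat_Kn S p \<in> carrier_mat (dim_u S) (dim_y S)"

definition tau_max :: "'p network_data \<Rightarrow> real" where
  "tau_max S =
     Max {tau S (num_delays S), tau_u S, tau_n S, tau_nc S, tau_u S + tau_nc S}"

definition subsystem_rhs_x ::
  "'p network_data \<Rightarrow> 'p \<Rightarrow> real \<Rightarrow> (real \<Rightarrow> real vec) \<Rightarrow> (real \<Rightarrow> real vec) \<Rightarrow> (real \<Rightarrow> real vec)
     \<Rightarrow> real \<Rightarrow> real vec" where
  "subsystem_rhs_x S p l w x \<xi> t =
     vec_sum (dim_x S) (\<lambda>k. mat_A S k *\<^sub>v x (t - tau S k)) {0..num_delays S}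
     + (mat_Bu S * mat_K S p * mat_Cy S) *\<^sub>v x (t - tau_u S)
     + l \<cdot>\<^sub>v ((mat_Bun S * mat_Cyn S) *\<^sub>v x (t - tau_n S))
     + l \<cdot>\<^sub>v ((mat_Bu S * mat_Kn S p * mat_Cy S) *\<^sub>v x (t - tau_u S - tau_nc S))
     + (mat_Bu S * mat_L S p) *\<^sub>v \<xi> (t - tau_u S)
     + mat_Bw S *\<^sub>v w t"

definition subsystem_rhs_xi ::
  "'p network_data \<Rightarrow> 'p \<Rightarrow> real \<Rightarrow> (real \<Rightarrow> real vec) \<Rightarrow> (real \<Rightarrow> real vec) \<Rightarrow> real \<Rightarrow> real vec"
  where
  "subsystem_rhs_xi S p l x \<xi> t =
     mat_J S p *\<^sub>v \<xi> t
     + (mat_F S p * mat_Cy S) *\<^sub>v x t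
     + l \<cdot>\<^sub>v ((mat_Fn S p * mat_Cy S) *\<^sub>v x (t - tau_nc S))"

text \<open>
  Forward solutions with a continuous initial segment on \<open>[-tau_max, 0]\<close>.
  The vectors live in a type without a topology, so continuity and the derivative
  (one-sided at \<open>0\<close>) are expressed componentwise.
\<close>

definition subsystem_solution ::
  "'p network_data \<Rightarrow> 'p \<Rightarrow> real \<Rightarrow> (real \<Rightarrow> real vec) \<Rightarrow> (real \<Rightarrow> real vec) \<Rightarrow> (real \<Rightarrow> real vec)
     \<Rightarrow> bool" where
  "subsystem_solution S p l w x \<xi> \<longleftrightarrow>
     (\<forall>t \<ge> - tau_max S. x t \<in> carrier_vec (dim_x S) \<and> \<xi> t \<in> carrier_vec (dim_xi S)) \<and>
     (\<forall>i < dim_x S. continuous_on {- tau_max S..} (\<lambda>t. x t $ i)) \<and>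
     (\<forall>i < dim_xi S. continuous_on {- tau_max S..} (\<lambda>t. \<xi> t $ i)) \<and>
     (\<forall>t \<ge> 0. \<forall>i < dim_x S.
        ((\<lambda>s. x s $ i) has_real_derivative subsystem_rhs_x S p l w x \<xi> t $ i)
          (at t within {0..})) \<and>
     (\<forall>t \<ge> 0. \<forall>i < dim_xi S.
        ((\<lambda>s. \<xi> s $ i) has_real_derivative subsystem_rhs_xi S p l x \<xi> t $ i)
          (at t within {0..}))"

definition subsystem_exp_stable :: "'p network_data \<Rightarrow> 'p \<Rightarrow> real \<Rightarrow> bool" where
  "subsystem_exp_stable S p l \<longleftrightarrow>
     (\<exists>c > 0. \<exists>\<gamma> > 0. \<forall>x \<xi>.
        subsystem_solution S p l (\<lambda>_. 0\<^sub>v (dim_w S)) x \<xi> \<longrightarrow>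
        (\<forall>t \<ge> 0. euclid_norm (x t @\<^sub>v \<xi> t) \<le>
           c * exp (- \<gamma> * t) * (SUP \<theta>\<in>{- tau_max S..0}. euclid_norm (x \<theta> @\<^sub>v \<xi> \<theta>))))"

definition Q_mat :: "'p network_data \<Rightarrow> 'p \<Rightarrow> complex \<Rightarrow> complex mat" where
  "Q_mat S p s = (let n = dim_x S; nc = dim_xi S in
     cmat (four_block_mat (mat_A S 0) (0\<^sub>m n nc) (mat_F S p * mat_Cy S) (mat_J S p))
     + mat_sum (n + nc) (n + nc)
         (\<lambda>k. exp (- s * complex_of_real (tau S k)) \<cdot>\<^sub>m
            cmat (four_block_mat (mat_A S k) (0\<^sub>m n nc) (0\<^sub>m nc n) (0\<^sub>m nc nc)))
         {1..num_delays S}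
     + exp (- s * complex_of_real (tau_u S)) \<cdot>\<^sub>m
         cmat (four_block_mat (mat_Bu S * mat_K S p * mat_Cy S) (mat_Bu S * mat_L S p)
                 (0\<^sub>m nc n) (0\<^sub>m nc nc)))"

definition R_mat :: "'p network_data \<Rightarrow> 'p \<Rightarrow> complex \<Rightarrow> complex mat" where
  "R_mat S p s = (let n = dim_x S; nc = dim_xi S in
     exp (- s * complex_of_real (tau_n S)) \<cdot>\<^sub>m
       cmat (four_block_mat (mat_Bun S * mat_Cyn S) (0\<^sub>m n nc) (0\<^sub>m nc n) (0\<^sub>m nc nc))
     + exp (- s * complex_of_real (tau_u S + tau_nc S)) \<cdot>\<^sub>m
         cmat (four_block_mat (mat_Bu S * mat_Kn S p * mat_Cy S) (0\<^sub>m n nc)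
                 (0\<^sub>m nc n) (0\<^sub>m nc nc))
     + exp (- s * complex_of_real (tau_nc S)) \<cdot>\<^sub>m
         cmat (four_block_mat (0\<^sub>m n n) (0\<^sub>m n nc) (mat_Fn S p * mat_Cy S) (0\<^sub>m nc nc)))"

definition C_ext :: "'p network_data \<Rightarrow> complex mat" where
  "C_ext S = cmat (four_block_mat (mat_Cz S) (0\<^sub>m (dim_z S) (dim_xi S))
                     (0\<^sub>m 0 (dim_x S)) (0\<^sub>m 0 (dim_xi S)))"

definition B_ext :: "'p network_data \<Rightarrow> complex mat" where
  "B_ext S = cmat (mat_Bw S @\<^sub>r 0\<^sub>m (dim_xi S) (dim_w S))"

definition network_transfer ::
  "'p network_data \<Rightarrow> 'p \<Rightarrow> nat \<Rightarrow> real mat \<Rightarrow> complex \<Rightarrow> complex mat" where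
  "network_transfer S p N P s =
     (1\<^sub>m N \<otimes>\<^sub>k C_ext S)
     * mat_inv (s \<cdot>\<^sub>m 1\<^sub>m (N * (dim_x S + dim_xi S))
                - 1\<^sub>m N \<otimes>\<^sub>k Q_mat S p s - cmat P \<otimes>\<^sub>k R_mat S p s)
     * (1\<^sub>m N \<otimes>\<^sub>k B_ext S)"

definition subsystem_transfer ::
  "'p network_data \<Rightarrow> 'p \<Rightarrow> real \<Rightarrow> complex \<Rightarrow> complex mat" where
  "subsystem_transfer S p l s =
     C_ext S
     * mat_inv (s \<cdot>\<^sub>m 1\<^sub>m (dim_x S + dim_xi S)
                - Q_mat S p s - complex_of_real l \<cdot>\<^sub>m R_mat S p s)
     * B_ext S"

text \<open>
  Both norms are genuine maxima: where the maximum is not attained, \<open>Greatest\<close> is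
  an unspecified value.
\<close>

definition hinf_norm :: "(complex \<Rightarrow> complex mat) \<Rightarrow> real" where
  "hinf_norm G = (GREATEST v. v \<in> (\<lambda>\<omega>. sigma1 (G (\<i> * complex_of_real \<omega>))) ` {0..})"

definition robust_hinf_norm :: "(real \<Rightarrow> complex \<Rightarrow> complex mat) \<Rightarrow> real \<Rightarrow> real \<Rightarrow> real" where
  "robust_hinf_norm G a b = (GREATEST v. v \<in> (\<lambda>l. hinf_norm (G l)) ` {a..b})"

definition admissible_adjacency :: "real \<Rightarrow> real \<Rightarrow> nat \<Rightarrow> real mat \<Rightarrow> bool" where
  "admissible_adjacency a b N P \<longleftrightarrow>
     P \<in> carrier_mat N N \<and> unitarily_diagonalizable (cmat P) \<and>
     spectrum (cmat P) \<subseteq> complex_of_real ` {a..b}"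

end

theory Submission
  imports Defs "HOL-Analysis.L2_Norm"
begin

text \<open>
  A unitary diagonalisation of the adjacency matrix \<open>P\<close> decouples the network into the
  subsystems whose parameters are the eigenvalues of \<open>P\<close>.  For an eigenvector \<open>u\<close> with
  eigenvalue \<open>l\<close>, the matrix \<open>u \<otimes> I\<close> intertwines the characteristic matrix of the
  network with that of the subsystem at \<open>l\<close>, hence also the two transfer functions, and since
  the eigenvectors are orthonormal the same holds for the Gram matrices.  So at each frequency the
  singular values of the network are those of the subsystems at the eigenvalues of \<open>P\<close>
  (\<open>singular_values_coupled_transfer\<close>), and the norm of the network is the maximum of the norms
  of these subsystems (\<open>hinf_norm_network\<close>).  The eigenvalues lie in \<open>[a, b]\<close>, which gives
  the upper bounds.  If the eigenvalues of all networks together are dense in \<open>[a, b]\<close>, then the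
  gain of the subsystem, being continuous in the parameter, comes arbitrarily close to its maximum
  at some of them (\<open>robust_hinf_norm_le_SUP\<close>).

  Both norms are defined as maxima, so it must be shown that these are attained.  Stability enters
  here: a characteristic root on the imaginary axis would give an oscillating solution that does
  not decay (\<open>exp_stable_imp_nonsingular\<close>), so the transfer function exists on the whole axis
  and is jointly continuous in parameter and frequency.  The largest singular value is continuous
  because it is the operator norm (\<open>sigma1_largest_gain\<close>).  The gain tends to zero at high
  frequency, uniformly in the parameter (\<open>gain_decays\<close>), since \<open>Q\<close> and \<open>R\<close> are
  bounded on the imaginary axis.  A nonnegative function of this kind attains its maximum
  (\<open>decaying_function_attains_max\<close>).
\<close>

section \<open>Singular values as gains\<close>

definition vnorm :: "complex vec \<Rightarrow> real" where
  "vnorm v = L2_set (\<lambda>i. norm (v $ i)) {..<dim_vec v}"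

text \<open>
  The real part of the Hermitian inner product, which is the cross term in the expansion of
  \<open>(vnorm (v - t w))\<^sup>2\<close> for real \<open>t\<close>.
\<close>

definition re_inner :: "complex vec \<Rightarrow> complex vec \<Rightarrow> real" where
  "re_inner v w = (\<Sum>i<dim_vec v. Re (v $ i * cnj (w $ i)))"

text \<open>
  A crude matrix norm: it dominates the operator norm (\<open>vnorm_mult_le\<close>) and is visibly
  continuous in the entries, which is what the continuity and decay estimates require.
\<close>

definition entry_sum :: "complex mat \<Rightarrow> real" where
  "entry_sum M = (\<Sum>i<dim_row M. \<Sum>j<dim_col M. norm (M $$ (i, j)))"

lemma mult_mat_vec_nth:
  "i < dim_row M \<Longrightarrow> dim_col M = dim_vec v \<Longrightarrow> (M *\<^sub>v v) $ i = (\<Sum>j<dim_vec v. M $$ (i, j) * v $ j)"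
  by (simp add: scalar_prod_def lessThan_atLeast0)

lemma vnorm_nonneg: "0 \<le> vnorm v"
  by (simp add: vnorm_def)

lemma norm_nth_le_vnorm: "i < dim_vec v \<Longrightarrow> norm (v $ i) \<le> vnorm v"
  unfolding vnorm_def by (rule member_le_L2_set) auto

lemma vnorm_eq_0_iff:
  assumes "v \<in> carrier_vec n"
  shows "vnorm v = 0 \<longleftrightarrow> v = 0\<^sub>v n"
  using assms unfolding vnorm_def by (subst L2_set_eq_0_iff) (auto intro!: eq_vecI)

lemma vnorm_pos: "v \<in> carrier_vec n \<Longrightarrow> v \<noteq> 0\<^sub>v n \<Longrightarrow> 0 < vnorm v"
  using vnorm_eq_0_iff[of v n] vnorm_nonneg[of v] by linarith

lemma vnorm_smult: "vnorm (c \<cdot>\<^sub>v v) = norm c * vnorm v"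
proof -
  have "vnorm (c \<cdot>\<^sub>v v) = L2_set (\<lambda>i. norm c * norm (v $ i)) {..<dim_vec v}"
    unfolding vnorm_def by (auto intro!: L2_set_cong simp: norm_mult)
  then show ?thesis by (simp add: vnorm_def L2_set_right_distrib)
qed

lemma vnorm_triangle:
  assumes "v \<in> carrier_vec n" "w \<in> carrier_vec n"
  shows "vnorm (v + w) \<le> vnorm v + vnorm w"
proof -
  have "vnorm (v + w) \<le> L2_set (\<lambda>i. norm (v $ i) + norm (w $ i)) {..<n}"
    unfolding vnorm_def using assms by (auto intro!: L2_set_mono norm_triangle_ineq)
  also have "\<dots> \<le> vnorm v + vnorm w"
    unfolding vnorm_def using assms by (auto intro: L2_set_triangle_ineq)
  finally show ?thesis .
qed

lemma vnorm_power2: "(vnorm v)\<^sup>2 = (\<Sum>i<dim_vec v. (norm (v $ i))\<^sup>2)"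
  unfolding vnorm_def L2_set_def by (simp add: sum_nonneg)

lemma re_inner_self: "re_inner v v = (vnorm v)\<^sup>2"
  unfolding re_inner_def vnorm_power2
  by (intro sum.cong refl) (metis Re_complex_of_real complex_norm_square)

lemma vnorm_power2_minus:
  assumes "v \<in> carrier_vec n" "w \<in> carrier_vec n"
  shows "(vnorm (v - complex_of_real t \<cdot>\<^sub>v w))\<^sup>2
    = (vnorm v)\<^sup>2 - 2 * t * re_inner v w + t\<^sup>2 * (vnorm w)\<^sup>2"
proof -
  have "(norm (a - complex_of_real t * b))\<^sup>2
      = (norm a)\<^sup>2 - 2 * t * Re (a * cnj b) + t\<^sup>2 * (norm b)\<^sup>2" for a b
    unfolding cmod_power2 by (simp add: power2_eq_square algebra_simps)
  then show ?thesis
    using assms unfolding vnorm_power2 re_inner_def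
    by (simp add: sum.distrib sum_subtractf sum_distrib_left del: times_complex.sel)
qed

lemma re_inner_smult_left: "re_inner (complex_of_real c \<cdot>\<^sub>v v) w = c * re_inner v w"
  unfolding re_inner_def by (simp add: sum_distrib_left algebra_simps)

lemma re_inner_minus_left:
  assumes "v \<in> carrier_vec n" "w \<in> carrier_vec n"
  shows "re_inner (v - w) u = re_inner v u - re_inner w u"
  using assms unfolding re_inner_def by (simp add: sum_subtractf algebra_simps)

lemma vnorm_mult_le: "dim_vec v = dim_col M \<Longrightarrow> vnorm (M *\<^sub>v v) \<le> entry_sum M * vnorm v"
proof -
  assume d: "dim_vec v = dim_col M"
  have "vnorm (M *\<^sub>v v) \<le> (\<Sum>i<dim_row M. norm ((M *\<^sub>v v) $ i))"
    unfolding vnorm_def by (simp add: L2_set_le_sum del: index_mult_mat_vec)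
  also have "\<dots> \<le> (\<Sum>i<dim_row M. \<Sum>j<dim_col M. norm (M $$ (i, j)) * vnorm v)"
  proof (intro sum_mono)
    fix i assume "i \<in> {..<dim_row M}"
    then have "(M *\<^sub>v v) $ i = (\<Sum>j<dim_col M. M $$ (i, j) * v $ j)"
      using d mult_mat_vec_nth[of i M v] by simp
    also have "norm \<dots> \<le> (\<Sum>j<dim_col M. norm (M $$ (i, j)) * vnorm v)"
      by (intro sum_norm_le) (auto simp: norm_mult d intro!: mult_left_mono norm_nth_le_vnorm)
    finally show "norm ((M *\<^sub>v v) $ i) \<le> (\<Sum>j<dim_col M. norm (M $$ (i, j)) * vnorm v)" .
  qed
  also have "\<dots> = entry_sum M * vnorm v"
    by (simp add: entry_sum_def sum_distrib_right)
  finally show ?thesis .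
qed

lemma entry_sum_nonneg: "0 \<le> entry_sum M"
  by (auto simp: entry_sum_def intro!: sum_nonneg)

lemma mat_adjoint_carrier [simp]: "M \<in> carrier_mat p m \<Longrightarrow> mat_adjoint M \<in> carrier_mat m p"
  unfolding mat_adjoint_def by auto

lemma mat_adjoint_index:
  "i < dim_col M \<Longrightarrow> j < dim_row M \<Longrightarrow> mat_adjoint M $$ (i, j) = conjugate (M $$ (j, i))"
  unfolding mat_adjoint_def by (simp add: mat_of_rows_index)

lemma dim_mat_adjoint [simp]:
  "dim_row (mat_adjoint M) = dim_col M" "dim_col (mat_adjoint M) = dim_row M"
  unfolding mat_adjoint_def by auto

lemma re_inner_adjoint:
  assumes M: "M \<in> carrier_mat p m" and v: "v \<in> carrier_vec m" and w: "w \<in> carrier_vec p"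
  shows "re_inner (M *\<^sub>v v) w = re_inner v (mat_adjoint M *\<^sub>v w)"
proof -
  have "re_inner (M *\<^sub>v v) w = (\<Sum>i<p. \<Sum>j<m. Re (M $$ (i, j) * v $ j * cnj (w $ i)))"
    unfolding re_inner_def using M v
    by (simp add: mult_mat_vec_nth sum_distrib_right del: index_mult_mat_vec times_complex.sel)
  also have "\<dots> = (\<Sum>j<m. \<Sum>i<p. Re (M $$ (i, j) * v $ j * cnj (w $ i)))"
    by (rule sum.swap)
  also have "\<dots> = re_inner v (mat_adjoint M *\<^sub>v w)"
    unfolding re_inner_def using M v w
    by (simp add: mult_mat_vec_nth sum_distrib_left mat_adjoint_index mult.commute mult.left_commute
        del: index_mult_mat_vec times_complex.sel)
  finally show ?thesis .
qed

lemma re_inner_adjoint_right: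
  assumes M: "M \<in> carrier_mat p m" and v: "v \<in> carrier_vec m" and w: "w \<in> carrier_vec m"
  shows "re_inner (M *\<^sub>v v) (M *\<^sub>v w) = re_inner ((mat_adjoint M * M) *\<^sub>v v) w"
proof -
  have sym: "re_inner x y = re_inner y x" if "dim_vec x = dim_vec y" for x y
    unfolding re_inner_def using that by (simp add: mult.commute)
  have c: "M *\<^sub>v v \<in> carrier_vec p" "mat_adjoint M *\<^sub>v (M *\<^sub>v v) \<in> carrier_vec m"
    using M v w by (auto intro: mult_mat_vec_carrier[OF mat_adjoint_carrier])
  have "re_inner (M *\<^sub>v v) (M *\<^sub>v w) = re_inner (M *\<^sub>v w) (M *\<^sub>v v)"
    by (rule sym) (use M in auto)
  also have "\<dots> = re_inner w (mat_adjoint M *\<^sub>v (M *\<^sub>v v))"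
    by (rule re_inner_adjoint[OF M w c(1)])
  also have "\<dots> = re_inner (mat_adjoint M *\<^sub>v (M *\<^sub>v v)) w"
    by (rule sym) (use c w M in auto)
  finally show ?thesis
    using assoc_mult_mat_vec[OF mat_adjoint_carrier[OF M] M v] by simp
qed

text \<open>
  A nonsingular matrix is bounded below because its adjugate divided by the determinant is a
  bounded inverse.
\<close>

lemma nonsingular_bounded_below:
  fixes H :: "complex mat"
  assumes H: "H \<in> carrier_mat n n" and d: "det H \<noteq> 0"
  shows "\<exists>c>0. \<forall>v\<in>carrier_vec n. vnorm v \<le> c * vnorm (H *\<^sub>v v)"
proof -
  let ?A = "adj_mat H"
  have A: "?A \<in> carrier_mat n n" and AH: "?A * H = det H \<cdot>\<^sub>m 1\<^sub>m n"
    using adj_mat[OF H] by auto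
  define c where "c = (entry_sum ?A + 1) / norm (det H)"
  have "vnorm v \<le> c * vnorm (H *\<^sub>v v)" if v: "v \<in> carrier_vec n" for v
  proof -
    have "?A *\<^sub>v (H *\<^sub>v v) = (det H \<cdot>\<^sub>m 1\<^sub>m n) *\<^sub>v v"
      using assoc_mult_mat_vec[OF A H v] AH by simp
    also have "\<dots> = det H \<cdot>\<^sub>v v"
      using v by (auto intro!: eq_vecI)
    finally have "norm (det H) * vnorm v = vnorm (?A *\<^sub>v (H *\<^sub>v v))"
      by (simp add: vnorm_smult)
    also have "\<dots> \<le> entry_sum ?A * vnorm (H *\<^sub>v v)"
      by (rule vnorm_mult_le) (use A H in auto)
    also have "\<dots> \<le> (entry_sum ?A + 1) * vnorm (H *\<^sub>v v)"
      by (simp add: mult_right_mono vnorm_nonneg)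
    finally show ?thesis using d by (simp add: c_def field_simps)
  qed
  moreover have "c > 0"
    using d entry_sum_nonneg[of ?A] by (simp add: c_def)
  ultimately show ?thesis by blast
qed

lemma gram_eigenvector:
  assumes M: "M \<in> carrier_mat p m" and v: "v \<in> carrier_vec m"
    and ev: "(mat_adjoint M * M) *\<^sub>v v = complex_of_real \<mu> \<cdot>\<^sub>v v"
  shows "(vnorm (M *\<^sub>v v))\<^sup>2 = \<mu> * (vnorm v)\<^sup>2"
proof -
  have "(vnorm (M *\<^sub>v v))\<^sup>2 = re_inner ((mat_adjoint M * M) *\<^sub>v v) v"
    using re_inner_adjoint_right[OF M v v] by (simp add: re_inner_self)
  also have "\<dots> = \<mu> * (vnorm v)\<^sup>2"
    by (simp add: ev re_inner_smult_left re_inner_self)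
  finally show ?thesis .
qed

text \<open>
  The numbers that bound the quadratic form of the Gram matrix; the least one is the squared
  operator norm.
\<close>

definition gain_bounds :: "complex mat \<Rightarrow> real set" where
  "gain_bounds M = {\<kappa>. \<forall>v\<in>carrier_vec (dim_col M). (vnorm (M *\<^sub>v v))\<^sup>2 \<le> \<kappa> * (vnorm v)\<^sup>2}"

lemma gain_bounds_nonneg:
  assumes M: "M \<in> carrier_mat p m" and m: "m \<ge> 1" and k: "\<kappa> \<in> gain_bounds M"
  shows "0 \<le> \<kappa>"
proof -
  let ?e = "unit_vec m 0 :: complex vec"
  have "?e $ 0 \<noteq> 0\<^sub>v m $ 0" using m by simp
  then have "?e \<noteq> 0\<^sub>v m" by metis
  then have e: "0 < (vnorm ?e)\<^sup>2" using vnorm_pos[of ?e m] by simp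
  have "(vnorm (M *\<^sub>v ?e))\<^sup>2 \<le> \<kappa> * (vnorm ?e)\<^sup>2"
    using k M unfolding gain_bounds_def by auto
  then have "0 \<le> \<kappa> * (vnorm ?e)\<^sup>2" by (rule order_trans[OF zero_le_power2])
  with e show ?thesis by (simp add: zero_le_mult_iff)
qed

text \<open>
  This replaces the usual compactness argument for the attainment of the operator norm.  Suppose
  that \<open>\<mu>\<close> is a bound but not an eigenvalue of \<open>M\<^sup>* M\<close>.  Put \<open>w = (\<mu> - M\<^sup>* M) v\<close>; then
  \<open>vnorm v\<close> is at most a fixed multiple of \<open>vnorm w\<close>.  Moving from \<open>v\<close> a small step
  against \<open>w\<close> lowers the nonnegative form \<open>\<mu> (vnorm v)\<^sup>2 - (vnorm (M v))\<^sup>2\<close> by a multiple of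
  \<open>(vnorm w)\<^sup>2\<close>, so the form at \<open>v\<close> itself is at least a multiple of \<open>(vnorm v)\<^sup>2\<close>,
  and \<open>\<mu>\<close> can be decreased.
\<close>

lemma gain_bounds_decrease:
  assumes M: "M \<in> carrier_mat p m" and \<mu>: "\<mu> \<in> gain_bounds M" "0 \<le> \<mu>"
    and ne: "\<not> eigenvalue (mat_adjoint M * M) (complex_of_real \<mu>)"
  shows "\<exists>\<epsilon>>0. \<mu> - \<epsilon> \<in> gain_bounds M"
proof -
  let ?G = "mat_adjoint M * M"
  define H where "H = char_matrix ?G (complex_of_real \<mu>)"
  have G: "?G \<in> carrier_mat m m" using M mat_adjoint_carrier by auto
  then have H: "H \<in> carrier_mat m m" unfolding H_def by simp
  have "det H \<noteq> 0" using ne unfolding H_def eigenvalue_det[OF G] .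
  from nonsingular_bounded_below[OF H this] obtain c where c: "c > 0"
    and cb: "\<And>v. v \<in> carrier_vec m \<Longrightarrow> vnorm v \<le> c * vnorm (H *\<^sub>v v)" by blast
  \<comment> \<open>The step length: the linear gain \<open>2 t\<close> has to beat the quadratic loss \<open>t\<^sup>2 \<mu>\<close>.\<close>
  define t where "t = 1 / (\<mu> + 1)"
  have t: "t > 0" and tm: "t * \<mu> \<le> 1" using \<mu>(2) by (auto simp: t_def)
  have "(vnorm (M *\<^sub>v v))\<^sup>2 \<le> (\<mu> - t / c\<^sup>2) * (vnorm v)\<^sup>2" if v: "v \<in> carrier_vec m" for v
  proof -
    define w where "w = - (H *\<^sub>v v)"
    have w: "w \<in> carrier_vec m" using H v by (simp add: w_def)
    have w_eq: "w = complex_of_real \<mu> \<cdot>\<^sub>v v - ?G *\<^sub>v v"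
      unfolding w_def H_def char_matrix_def using G v M
      by (auto intro!: eq_vecI simp: add_scalar_prod_distrib[of _ m])
    have vw: "vnorm w = vnorm (H *\<^sub>v v)"
      unfolding w_def vnorm_def by (auto intro!: L2_set_cong simp del: index_mult_mat_vec)
    have inner: "\<mu> * re_inner v w - re_inner (M *\<^sub>v v) (M *\<^sub>v w) = (vnorm w)\<^sup>2"
    proof -
      have "(vnorm w)\<^sup>2 = re_inner (complex_of_real \<mu> \<cdot>\<^sub>v v - ?G *\<^sub>v v) w"
        by (simp add: re_inner_self flip: w_eq)
      also have "\<dots> = \<mu> * re_inner v w - re_inner (?G *\<^sub>v v) w"
        by (subst re_inner_minus_left[of _ m])
          (use v G in \<open>auto simp: re_inner_smult_left\<close>)
      finally show ?thesis using re_inner_adjoint_right[OF M v w] by simp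
    qed
    let ?u = "v - complex_of_real t \<cdot>\<^sub>v w"
    have u: "?u \<in> carrier_vec m" using v w by auto
    have Mu: "M *\<^sub>v ?u = M *\<^sub>v v - complex_of_real t \<cdot>\<^sub>v (M *\<^sub>v w)"
      using mult_minus_distrib_mat_vec[OF M v, of "complex_of_real t \<cdot>\<^sub>v w"] mult_mat_vec[OF M w] w
      by simp
    have "(vnorm (M *\<^sub>v ?u))\<^sup>2 \<le> \<mu> * (vnorm ?u)\<^sup>2"
      using \<mu>(1) u M unfolding gain_bounds_def by auto
    then have "(vnorm (M *\<^sub>v v))\<^sup>2 - 2 * t * re_inner (M *\<^sub>v v) (M *\<^sub>v w) + t\<^sup>2 * (vnorm (M *\<^sub>v w))\<^sup>2
      \<le> \<mu> * ((vnorm v)\<^sup>2 - 2 * t * re_inner v w + t\<^sup>2 * (vnorm w)\<^sup>2)"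
      unfolding Mu using vnorm_power2_minus[OF v w, of t]
        vnorm_power2_minus[of "M *\<^sub>v v" p "M *\<^sub>v w" t] M v w by auto
    moreover have "0 \<le> t\<^sup>2 * (vnorm (M *\<^sub>v w))\<^sup>2" by simp
    ultimately have "(vnorm (M *\<^sub>v v))\<^sup>2 \<le> \<mu> * (vnorm v)\<^sup>2
        - 2 * t * (\<mu> * re_inner v w - re_inner (M *\<^sub>v v) (M *\<^sub>v w)) + t * (t * \<mu>) * (vnorm w)\<^sup>2"
      by (simp add: algebra_simps power2_eq_square)
    also have "\<dots> = \<mu> * (vnorm v)\<^sup>2 - t * (2 - t * \<mu>) * (vnorm w)\<^sup>2"
      unfolding inner by (simp add: algebra_simps)
    also have "\<dots> \<le> \<mu> * (vnorm v)\<^sup>2 - t * (vnorm w)\<^sup>2"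
    proof -
      have "t * 1 * (vnorm w)\<^sup>2 \<le> t * (2 - t * \<mu>) * (vnorm w)\<^sup>2"
        using t tm by (intro mult_right_mono mult_left_mono) auto
      then show ?thesis by simp
    qed
    also have "\<dots> \<le> \<mu> * (vnorm v)\<^sup>2 - t * ((vnorm v)\<^sup>2 / c\<^sup>2)"
    proof -
      have "(vnorm v)\<^sup>2 \<le> (c * vnorm w)\<^sup>2"
        using cb[OF v] vw by (intro power_mono) (auto simp: vnorm_nonneg)
      then have "(vnorm v)\<^sup>2 / c\<^sup>2 \<le> (vnorm w)\<^sup>2"
        using c by (simp add: power_mult_distrib field_simps)
      then have "t * ((vnorm v)\<^sup>2 / c\<^sup>2) \<le> t * (vnorm w)\<^sup>2"
        using t by (intro mult_left_mono) auto
      then show ?thesis by simp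
    qed
    finally show ?thesis by (simp add: algebra_simps)
  qed
  then have "\<mu> - t / c\<^sup>2 \<in> gain_bounds M" using M unfolding gain_bounds_def by auto
  moreover have "t / c\<^sup>2 > 0" using t c by simp
  ultimately show ?thesis by blast
qed

text \<open>
  The link between \<open>sigma1\<close>, which is defined through eigenvalues of the Gram matrix, and the
  operator norm: the infimum of \<open>gain_bounds M\<close> must be an eigenvalue, since otherwise it could
  be decreased, and every eigenvalue is the squared gain of its eigenvector.  Without columns there
  would be no singular value at all.
\<close>

lemma sigma1_largest_gain:
  assumes M: "M \<in> carrier_mat p m" and m: "m \<ge> 1"
  shows "0 \<le> sigma1 M"
    and "\<And>v. v \<in> carrier_vec m \<Longrightarrow> vnorm (M *\<^sub>v v) \<le> sigma1 M * vnorm v"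
    and "\<exists>v\<in>carrier_vec m. v \<noteq> 0\<^sub>v m \<and> vnorm (M *\<^sub>v v) = sigma1 M * vnorm v"
    and "finite (singular_values M)" and "sigma1 M \<in> singular_values M"
proof -
  let ?G = "mat_adjoint M * M"
  have G: "?G \<in> carrier_mat m m" using M mat_adjoint_carrier by auto
  have bdd: "bdd_below (gain_bounds M)"
    using gain_bounds_nonneg[OF M m] by (intro bdd_belowI)
  have "(entry_sum M)\<^sup>2 \<in> gain_bounds M"
    unfolding gain_bounds_def using vnorm_mult_le[of _ M]
    by (auto simp flip: power_mult_distrib intro!: power_mono vnorm_nonneg)
  then have ne: "gain_bounds M \<noteq> {}" by auto
  define \<mu> where "\<mu> = Inf (gain_bounds M)"
  have mem: "\<mu> \<in> gain_bounds M"
    unfolding gain_bounds_def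
  proof (intro CollectI ballI)
    fix v :: "complex vec" assume v: "v \<in> carrier_vec (dim_col M)"
    show "(vnorm (M *\<^sub>v v))\<^sup>2 \<le> \<mu> * (vnorm v)\<^sup>2"
    proof (cases "vnorm v = 0")
      case True
      then show ?thesis using vnorm_mult_le[of v M] v vnorm_nonneg[of "M *\<^sub>v v"] by auto
    next
      case False
      then have "(vnorm v)\<^sup>2 > 0" by simp
      moreover have "(vnorm (M *\<^sub>v v))\<^sup>2 / (vnorm v)\<^sup>2 \<le> \<mu>"
        unfolding \<mu>_def using ne
      proof (rule cInf_greatest)
        fix \<kappa> assume "\<kappa> \<in> gain_bounds M"
        with v \<open>(vnorm v)\<^sup>2 > 0\<close> show "(vnorm (M *\<^sub>v v))\<^sup>2 / (vnorm v)\<^sup>2 \<le> \<kappa>"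
          unfolding gain_bounds_def by (auto simp: divide_le_eq)
      qed
      ultimately show ?thesis by (simp add: divide_le_eq)
    qed
  qed
  have \<mu>0: "0 \<le> \<mu>" by (rule gain_bounds_nonneg[OF M m mem])
  have ev: "eigenvalue ?G (complex_of_real \<mu>)"
  proof (rule ccontr)
    assume "\<not> ?thesis"
    from gain_bounds_decrease[OF M mem \<mu>0 this] obtain \<epsilon> where "\<epsilon> > 0" "\<mu> - \<epsilon> \<in> gain_bounds M"
      by blast
    then show False using cInf_lower[OF _ bdd, of "\<mu> - \<epsilon>"] unfolding \<mu>_def by simp
  qed
  have top: "s \<le> sqrt \<mu>" if "s \<in> singular_values M" for s
  proof -
    from that obtain \<nu> where s: "s = sqrt \<nu>" and "\<nu> \<ge> 0"
      and e: "eigenvalue ?G (complex_of_real \<nu>)" unfolding singular_values_def by auto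
    from e G obtain v where v: "v \<in> carrier_vec m" "v \<noteq> 0\<^sub>v m"
      and Gv: "?G *\<^sub>v v = complex_of_real \<nu> \<cdot>\<^sub>v v"
      unfolding eigenvalue_def eigenvector_def by auto
    have "\<nu> * (vnorm v)\<^sup>2 \<le> \<mu> * (vnorm v)\<^sup>2"
      using mem v M unfolding gain_bounds_def gram_eigenvector[OF M v(1) Gv, symmetric] by auto
    then show ?thesis using vnorm_pos[OF v] s by simp
  qed
  show fin: "finite (singular_values M)"
  proof (rule finite_subset)
    show "singular_values M \<subseteq> (\<lambda>z. sqrt (Re z)) ` spectrum ?G"
      unfolding singular_values_def spectrum_def by (auto simp: image_iff) force
    show "finite ((\<lambda>z. sqrt (Re z)) ` spectrum ?G)"
      using card_finite_spectrum[OF G] by auto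
  qed
  have memb: "sqrt \<mu> \<in> singular_values M"
    unfolding singular_values_def using \<mu>0 ev by auto
  have eq: "sigma1 M = sqrt \<mu>"
    unfolding sigma1_def using fin top memb by (intro Max_eqI) auto
  show "0 \<le> sigma1 M" using eq \<mu>0 by simp
  show "sigma1 M \<in> singular_values M" using eq memb by simp
  show "vnorm (M *\<^sub>v v) \<le> sigma1 M * vnorm v" if "v \<in> carrier_vec m" for v
  proof (rule power2_le_imp_le)
    show "(vnorm (M *\<^sub>v v))\<^sup>2 \<le> (sigma1 M * vnorm v)\<^sup>2"
      using mem that M \<mu>0 unfolding eq gain_bounds_def by (auto simp: power_mult_distrib)
    show "0 \<le> sigma1 M * vnorm v" using eq \<mu>0 vnorm_nonneg by simp
  qed
  from ev G obtain v where v: "v \<in> carrier_vec m" "v \<noteq> 0\<^sub>v m"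
    and Gv: "?G *\<^sub>v v = complex_of_real \<mu> \<cdot>\<^sub>v v"
    unfolding eigenvalue_def eigenvector_def by auto
  have "(vnorm (M *\<^sub>v v))\<^sup>2 = (sigma1 M * vnorm v)\<^sup>2"
    using gram_eigenvector[OF M v(1) Gv] \<mu>0 by (simp add: eq power_mult_distrib)
  then have "vnorm (M *\<^sub>v v) = sigma1 M * vnorm v"
    using vnorm_nonneg eq \<mu>0 by (subst (asm) power2_eq_iff_nonneg) auto
  with v show "\<exists>v\<in>carrier_vec m. v \<noteq> 0\<^sub>v m \<and> vnorm (M *\<^sub>v v) = sigma1 M * vnorm v" by blast
qed

lemma sigma1_le_if_gain:
  assumes M: "M \<in> carrier_mat p m" and m: "m \<ge> 1"
    and "\<And>v. v \<in> carrier_vec m \<Longrightarrow> vnorm (M *\<^sub>v v) \<le> c * vnorm v"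
  shows "sigma1 M \<le> c"
proof -
  from sigma1_largest_gain(3)[OF M m] obtain v where v: "v \<in> carrier_vec m" "v \<noteq> 0\<^sub>v m"
    and eq: "vnorm (M *\<^sub>v v) = sigma1 M * vnorm v" by blast
  then show ?thesis using assms(3)[OF v(1)] vnorm_pos[OF v] by simp
qed

text \<open>
  The triangle inequality of the operator norm; it makes \<open>sigma1\<close> continuous in the entries.
\<close>

lemma sigma1_lipschitz:
  assumes A: "A \<in> carrier_mat p m" and B: "B \<in> carrier_mat p m" and m: "m \<ge> 1"
  shows "sigma1 A \<le> sigma1 B + entry_sum (A - B)"
proof (rule sigma1_le_if_gain[OF A m])
  fix v :: "complex vec" assume v: "v \<in> carrier_vec m"
  have "A *\<^sub>v v = B *\<^sub>v v + (A - B) *\<^sub>v v"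
    using A B v minus_mult_distrib_mat_vec[OF A B v] by (auto intro!: eq_vecI)
  also have "vnorm \<dots> \<le> vnorm (B *\<^sub>v v) + vnorm ((A - B) *\<^sub>v v)"
    by (rule vnorm_triangle[of _ p]) (use A B v mult_mat_vec_carrier[OF minus_carrier_mat[OF B]] in auto)
  also have "\<dots> \<le> sigma1 B * vnorm v + entry_sum (A - B) * vnorm v"
    by (intro add_mono sigma1_largest_gain(2)[OF B m v] vnorm_mult_le) (use B v in auto)
  finally show "vnorm (A *\<^sub>v v) \<le> (sigma1 B + entry_sum (A - B)) * vnorm v"
    by (simp add: algebra_simps)
qed

section \<open>Continuity and attained maxima\<close>

lemma mat_inv:
  fixes A :: "'a::field mat"
  assumes A: "A \<in> carrier_mat n n" and d: "det A \<noteq> 0"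
  shows mat_inv_carrier: "mat_inv A \<in> carrier_mat n n"
    and mat_inv_right: "A * mat_inv A = 1\<^sub>m n"
    and mat_inv_left: "mat_inv A * A = 1\<^sub>m n"
proof -
  have "mat_inverse A \<noteq> None"
    using mat_inverse(1)[OF A, where b = "()"] det_non_zero_imp_unit[OF A d, where b = "()"] by blast
  then show "mat_inv A \<in> carrier_mat n n" "A * mat_inv A = 1\<^sub>m n" "mat_inv A * A = 1\<^sub>m n"
    using mat_inverse(2)[OF A] by (auto simp: mat_inv_def)
qed

lemma mat_inv_adj_mat:
  fixes A :: "'a::field mat"
  assumes A: "A \<in> carrier_mat n n" and d: "det A \<noteq> 0"
  shows "mat_inv A = inverse (det A) \<cdot>\<^sub>m adj_mat A"
proof -
  note I = mat_inv[OF A d] and J = adj_mat[OF A]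
  have "inverse (det A) \<cdot>\<^sub>m adj_mat A = inverse (det A) \<cdot>\<^sub>m ((mat_inv A * A) * adj_mat A)"
    using I J by simp
  also have "(mat_inv A * A) * adj_mat A = mat_inv A * (det A \<cdot>\<^sub>m 1\<^sub>m n)"
    using assoc_mult_mat[OF I(1) A J(1)] J(2) by simp
  also have "\<dots> = det A \<cdot>\<^sub>m mat_inv A"
    using mult_smult_distrib[OF I(1) one_carrier_mat, of "det A"] I(1) by simp
  also have "inverse (det A) \<cdot>\<^sub>m \<dots> = mat_inv A"
    using d I(1) by (auto intro!: eq_matI)
  finally show ?thesis by simp
qed

text \<open>
  The type of matrices carries no topology, so continuity is a statement about entries.  The
  dimensions have to be constant for it to make sense.
\<close>

definition entrywise_continuous_on ::
  "'a::topological_space set \<Rightarrow> nat \<Rightarrow> nat \<Rightarrow> ('a \<Rightarrow> complex mat) \<Rightarrow> bool" where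
  "entrywise_continuous_on X p m F \<longleftrightarrow>
     (\<forall>x\<in>X. F x \<in> carrier_mat p m) \<and> (\<forall>i<p. \<forall>j<m. continuous_on X (\<lambda>x. F x $$ (i, j)))"

lemma entrywise_continuous_on_const:
  "A \<in> carrier_mat p m \<Longrightarrow> entrywise_continuous_on X p m (\<lambda>_. A)"
  by (simp add: entrywise_continuous_on_def)

lemma entrywise_continuous_on_mult:
  assumes F: "entrywise_continuous_on X p m F" and G: "entrywise_continuous_on X m k G"
  shows "entrywise_continuous_on X p k (\<lambda>x. F x * G x)"
  unfolding entrywise_continuous_on_def
proof (intro conjI ballI allI impI)
  show "F x * G x \<in> carrier_mat p k" if "x \<in> X" for x
    using that F G unfolding entrywise_continuous_on_def by auto
next
  fix i j assume ij: "i < p" "j < k"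
  have "continuous_on X (\<lambda>x. \<Sum>l<m. F x $$ (i, l) * G x $$ (l, j))"
    using F G ij unfolding entrywise_continuous_on_def by (intro continuous_intros) auto
  moreover have "(\<Sum>l<m. F x $$ (i, l) * G x $$ (l, j)) = (F x * G x) $$ (i, j)" if "x \<in> X" for x
  proof -
    have "F x \<in> carrier_mat p m" "G x \<in> carrier_mat m k"
      using that F G unfolding entrywise_continuous_on_def by auto
    with ij show ?thesis by (simp add: scalar_prod_def lessThan_atLeast0)
  qed
  ultimately show "continuous_on X (\<lambda>x. (F x * G x) $$ (i, j))"
    by (rule continuous_on_eq) auto
qed

lemma continuous_on_det:
  assumes F: "entrywise_continuous_on X n n F"
  shows "continuous_on X (\<lambda>x. det (F x))"
proof -
  have "continuous_on X (\<lambda>x. \<Sum>\<pi>\<in>{\<pi>. \<pi> permutes {0..<n}}.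
      signof \<pi> * (\<Prod>i=0..<n. F x $$ (i, \<pi> i)))"
  proof (intro continuous_intros)
    fix \<pi> i assume "\<pi> \<in> {\<pi>. \<pi> permutes {0..<n}}" and i: "i \<in> {0..<n}"
    then have "\<pi> i < n" using permutes_in_image[of \<pi> "{0..<n}" i] by auto
    with i F show "continuous_on X (\<lambda>x. F x $$ (i, \<pi> i))"
      unfolding entrywise_continuous_on_def by auto
  qed
  moreover have "(\<Sum>\<pi>\<in>{\<pi>. \<pi> permutes {0..<n}}. signof \<pi> * (\<Prod>i=0..<n. F x $$ (i, \<pi> i)))
      = det (F x)" if "x \<in> X" for x
  proof -
    have "F x \<in> carrier_mat n n" using that F unfolding entrywise_continuous_on_def by auto
    then show ?thesis by (simp add: det_def)
  qed
  ultimately show ?thesis by (rule continuous_on_eq) auto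
qed

text \<open>
  By Cramer's rule the entries of the inverse are quotients of polynomials in the entries.
\<close>

lemma entrywise_continuous_on_mat_inv:
  assumes F: "entrywise_continuous_on X n n F" and d: "\<And>x. x \<in> X \<Longrightarrow> det (F x) \<noteq> 0"
  shows "entrywise_continuous_on X n n (\<lambda>x. mat_inv (F x))"
  unfolding entrywise_continuous_on_def
proof (intro conjI ballI allI impI)
  have c: "F x \<in> carrier_mat n n" if "x \<in> X" for x
    using that F unfolding entrywise_continuous_on_def by auto
  then show "mat_inv (F x) \<in> carrier_mat n n" if "x \<in> X" for x
    using that d mat_inv_carrier by blast
  fix i j assume ij: "i < n" "j < n"
  have "entrywise_continuous_on X (n - 1) (n - 1) (\<lambda>x. mat_delete (F x) j i)"
    unfolding entrywise_continuous_on_def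
  proof (intro conjI ballI allI impI)
    show "mat_delete (F x) j i \<in> carrier_mat (n - 1) (n - 1)" if "x \<in> X" for x
      using c[OF that] by (rule mat_delete_carrier)
    fix k l assume kl: "k < n - 1" "l < n - 1"
    let ?k = "if k < j then k else Suc k" and ?l = "if l < i then l else Suc l"
    have "continuous_on X (\<lambda>x. F x $$ (?k, ?l))"
      using F kl unfolding entrywise_continuous_on_def by auto
    then show "continuous_on X (\<lambda>x. mat_delete (F x) j i $$ (k, l))"
      by (rule continuous_on_eq) (use kl in \<open>auto simp: mat_delete_def dest!: c\<close>)
  qed
  then have "continuous_on X (\<lambda>x. inverse (det (F x)) * ((-1) ^ (j + i) * det (mat_delete (F x) j i)))"
    using d by (intro continuous_intros continuous_on_det[OF F] continuous_on_det) auto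
  then show "continuous_on X (\<lambda>x. mat_inv (F x) $$ (i, j))"
  proof (rule continuous_on_eq)
    fix x assume x: "x \<in> X"
    show "inverse (det (F x)) * ((-1) ^ (j + i) * det (mat_delete (F x) j i)) = mat_inv (F x) $$ (i, j)"
      unfolding mat_inv_adj_mat[OF c[OF x] d[OF x]] using c[OF x] ij
      by (simp add: adj_mat_def cofactor_def)
  qed
qed

lemma continuous_on_sigma1:
  assumes F: "entrywise_continuous_on X p m F" and m: "m \<ge> 1"
  shows "continuous_on X (\<lambda>x. sigma1 (F x))"
  unfolding continuous_on_def
proof
  fix x assume x: "x \<in> X"
  have c: "F y \<in> carrier_mat p m" if "y \<in> X" for y
    using that F unfolding entrywise_continuous_on_def by auto
  define g where "g y = (\<Sum>i<p. \<Sum>j<m. norm (F y $$ (i, j) - F x $$ (i, j)))" for y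
  have "(g \<longlongrightarrow> (\<Sum>i<p. \<Sum>j<m. norm (F x $$ (i, j) - F x $$ (i, j)))) (at x within X)"
    unfolding g_def using F x unfolding entrywise_continuous_on_def continuous_on_def
    by (intro tendsto_intros) auto
  then have g0: "(g \<longlongrightarrow> 0) (at x within X)" by simp
  have "\<bar>sigma1 (F y) - sigma1 (F x)\<bar> \<le> g y" if y: "y \<in> X" for y
  proof -
    have "entry_sum (F y - F x) = g y" "entry_sum (F x - F y) = g y"
      using c[OF x] c[OF y] unfolding entry_sum_def g_def by (auto simp: norm_minus_commute)
    then show ?thesis
      using sigma1_lipschitz[OF c[OF y] c[OF x] m] sigma1_lipschitz[OF c[OF x] c[OF y] m] by linarith
  qed
  then have "((\<lambda>y. sigma1 (F y) - sigma1 (F x)) \<longlongrightarrow> 0) (at x within X)"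
    by (intro tendsto_rabs_zero_cancel[OF tendsto_sandwich[OF _ _ tendsto_const g0]])
      (auto simp: eventually_at_filter)
  then show "((\<lambda>y. sigma1 (F y)) \<longlongrightarrow> sigma1 (F x)) (at x within X)"
    by (rule LIM_zero_cancel)
qed

text \<open>
  What makes the maxima in the definitions of both norms exist, although the frequency axis is
  not compact: where the function is below one of its positive values, it can be
  ignored, and what remains is compact.  If there is no positive value, the function vanishes.
\<close>

lemma decaying_function_attains_max:
  fixes f :: "'a::topological_space \<times> real \<Rightarrow> real"
  assumes K: "compact K" "K \<noteq> {}" and f: "continuous_on (K \<times> {0..}) f"
    and nonneg: "\<And>x w. x \<in> K \<Longrightarrow> 0 \<le> w \<Longrightarrow> 0 \<le> f (x, w)"
    and decay: "\<And>e. e > 0 \<Longrightarrow> \<exists>W. \<forall>x\<in>K. \<forall>w>W. 0 \<le> w \<longrightarrow> f (x, w) < e"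
  shows "\<exists>x\<in>K. \<exists>w\<ge>0. \<forall>y\<in>K. \<forall>v\<ge>0. f (y, v) \<le> f (x, w)"
proof (cases "\<exists>x\<in>K. \<exists>w\<ge>0. f (x, w) > 0")
  case False
  from K(2) obtain x where "x \<in> K" by blast
  moreover from False nonneg have "f (y, v) = 0" if "y \<in> K" "0 \<le> v" for y v
    using that by (meson antisym not_less)
  ultimately show ?thesis by (intro bexI[of _ x] exI[of _ 0]) auto
next
  case True
  then obtain x0 w0 where 0: "x0 \<in> K" "0 \<le> w0" "f (x0, w0) > 0" by blast
  from decay[OF 0(3)] obtain W
    where W: "\<And>x w. x \<in> K \<Longrightarrow> w > W \<Longrightarrow> 0 \<le> w \<Longrightarrow> f (x, w) < f (x0, w0)" by blast
  have w0: "w0 \<le> W" using W[OF 0(1), of w0] 0(2) by fastforce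
  have "\<exists>z\<in>K \<times> {0..W}. \<forall>y\<in>K \<times> {0..W}. f y \<le> f z"
  proof (rule continuous_attains_sup)
    show "compact (K \<times> {0..W})" using K(1) by (intro compact_Times) auto
    show "K \<times> {0..W} \<noteq> {}" using 0 w0 by auto
    show "continuous_on (K \<times> {0..W}) f" by (rule continuous_on_subset[OF f]) auto
  qed
  then obtain x w where xw: "x \<in> K" "0 \<le> w"
    and max: "\<And>y v. y \<in> K \<Longrightarrow> 0 \<le> v \<Longrightarrow> v \<le> W \<Longrightarrow> f (y, v) \<le> f (x, w)" by auto
  have "f (y, v) \<le> f (x, w)" if "y \<in> K" "0 \<le> v" for y v
  proof (cases "v \<le> W")
    case False
    then have "f (y, v) < f (x0, w0)" using W that by simp
    also have "\<dots> \<le> f (x, w)" using max 0 w0 by blast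
    finally show ?thesis by simp
  qed (use max that in blast)
  with xw show ?thesis by blast
qed

section \<open>Kronecker products and adjoints\<close>

lemma dim_kron [simp]:
  "dim_row (A \<otimes>\<^sub>k B) = dim_row A * dim_row B" "dim_col (A \<otimes>\<^sub>k B) = dim_col A * dim_col B"
  by (auto simp: kron_def)

lemma kron_carrier [simp]:
  "A \<in> carrier_mat a b \<Longrightarrow> B \<in> carrier_mat c d \<Longrightarrow> A \<otimes>\<^sub>k B \<in> carrier_mat (a * c) (b * d)"
  by auto

lemma kron_index:
  "i < dim_row A * dim_row B \<Longrightarrow> j < dim_col A * dim_col B \<Longrightarrow>
    (A \<otimes>\<^sub>k B) $$ (i, j) = A $$ (i div dim_row B, j div dim_col B) * B $$ (i mod dim_row B, j mod dim_col B)"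
  by (simp add: kron_def)

lemma div_mod_bounds:
  fixes i :: nat
  assumes "i < a * b"
  shows "i div b < a" and "i mod b < b"
  using assms by (auto simp: less_mult_imp_div_less) (metis mod_less_divisor mult_0_right not_gr0 not_less0)

text \<open>
  Row and column indices of a Kronecker product encode pairs by quotient and remainder; this
  turns the sum over encoded indices in a matrix product into a double sum.
\<close>

lemma sum_div_mod:
  fixes f :: "nat \<Rightarrow> nat \<Rightarrow> 'a::comm_monoid_add"
  shows "(\<Sum>k<a * b. f (k div b) (k mod b)) = (\<Sum>i<a. \<Sum>j<b. f i j)"
proof -
  have "(\<Sum>k<a * b. f (k div b) (k mod b)) = (\<Sum>(i, j)\<in>{..<a} \<times> {..<b}. f i j)"
  proof (rule sum.reindex_bij_witness[of _ "\<lambda>(i, j). i * b + j" "\<lambda>k. (k div b, k mod b)"])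
    fix ij assume "ij \<in> {..<a} \<times> {..<b}"
    then obtain i j where ij: "ij = (i, j)" "i < a" "j < b" by auto
    have "i * b + j < Suc i * b" using ij by simp
    also have "\<dots> \<le> a * b" using ij by (intro mult_right_mono) auto
    finally show "(case ij of (i, j) \<Rightarrow> i * b + j) \<in> {..<a * b}" using ij by simp
    show "((case ij of (i, j) \<Rightarrow> i * b + j) div b, (case ij of (i, j) \<Rightarrow> i * b + j) mod b) = ij"
      using ij by auto
  qed (auto simp: div_mod_bounds)
  then show ?thesis by (simp add: sum.cartesian_product)
qed

text \<open>
  The mixed-product rule, on which all intertwining relations below rest.
\<close>

lemma kron_mult:
  fixes A :: "'a::comm_semiring_0 mat"
  assumes "A \<in> carrier_mat a b" "C \<in> carrier_mat b c" "B \<in> carrier_mat d e" "D \<in> carrier_mat e f"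
  shows "(A \<otimes>\<^sub>k B) * (C \<otimes>\<^sub>k D) = (A * C) \<otimes>\<^sub>k (B * D)"
proof (rule eq_matI)
  fix i j assume "i < dim_row ((A * C) \<otimes>\<^sub>k (B * D))" "j < dim_col ((A * C) \<otimes>\<^sub>k (B * D))"
  then have ij: "i < a * d" "j < c * f" using assms by auto
  note b = div_mod_bounds[OF ij(1)] div_mod_bounds[OF ij(2)]
  let ?g = "\<lambda>k l. (A $$ (i div d, k) * B $$ (i mod d, l)) * (C $$ (k, j div f) * D $$ (l, j mod f))"
  have "((A \<otimes>\<^sub>k B) * (C \<otimes>\<^sub>k D)) $$ (i, j) = (\<Sum>k<b * e. ?g (k div e) (k mod e))"
    using assms ij by (simp add: scalar_prod_def kron_index lessThan_atLeast0)
  also have "\<dots> = (\<Sum>k<b. \<Sum>l<e. ?g k l)" by (rule sum_div_mod)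
  also have "\<dots> = (\<Sum>k<b. A $$ (i div d, k) * C $$ (k, j div f)) * (\<Sum>l<e. B $$ (i mod d, l) * D $$ (l, j mod f))"
    by (simp add: sum_product ac_simps)
  also have "\<dots> = ((A * C) \<otimes>\<^sub>k (B * D)) $$ (i, j)"
    using assms ij b by (simp add: scalar_prod_def kron_index lessThan_atLeast0)
  finally show "((A \<otimes>\<^sub>k B) * (C \<otimes>\<^sub>k D)) $$ (i, j) = ((A * C) \<otimes>\<^sub>k (B * D)) $$ (i, j)" .
qed (use assms in auto)

lemma mat_adjoint_adjoint [simp]: "mat_adjoint (mat_adjoint A) = A"
  by (rule eq_matI) (auto simp: mat_adjoint_index)

lemma mat_adjoint_one [simp]: "mat_adjoint (1\<^sub>m n :: complex mat) = 1\<^sub>m n"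
  by (rule eq_matI) (auto simp: mat_adjoint_index)

lemma mat_adjoint_kron: "mat_adjoint (A \<otimes>\<^sub>k B) = mat_adjoint A \<otimes>\<^sub>k mat_adjoint (B :: complex mat)"
  by (rule eq_matI) (auto simp: mat_adjoint_index kron_index div_mod_bounds)

lemma mat_adjoint_mult:
  fixes A :: "complex mat"
  assumes "A \<in> carrier_mat a b" "B \<in> carrier_mat b c"
  shows "mat_adjoint (A * B) = mat_adjoint B * mat_adjoint A"
  by (rule eq_matI)
    (use assms in \<open>auto simp: mat_adjoint_index scalar_prod_def mult.commute intro!: sum.cong\<close>)

section \<open>Modal decomposition of a network\<close>

text \<open>
  The characteristic matrix of a network with \<open>N\<close> nodes, coupled through \<open>P\<close>.  A single
  subsystem with parameter \<open>d\<close> is the case \<open>N = 1\<close>, \<open>P = (d)\<close>, so that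
  statements about changing the coupling matrix also relate the network to its subsystems.
\<close>

definition closed_loop :: "complex mat \<Rightarrow> complex mat \<Rightarrow> complex \<Rightarrow> nat \<Rightarrow> complex mat \<Rightarrow> complex mat" where
  "closed_loop Q R s N P = s \<cdot>\<^sub>m 1\<^sub>m (N * dim_row Q) - 1\<^sub>m N \<otimes>\<^sub>k Q - P \<otimes>\<^sub>k R"

definition coupled_transfer ::
  "complex mat \<Rightarrow> complex mat \<Rightarrow> complex mat \<Rightarrow> complex mat \<Rightarrow> complex \<Rightarrow> nat \<Rightarrow> complex mat \<Rightarrow> complex mat"
  where
  "coupled_transfer C B Q R s N P =
     (1\<^sub>m N \<otimes>\<^sub>k C) * mat_inv (closed_loop Q R s N P) * (1\<^sub>m N \<otimes>\<^sub>k B)"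

lemma closed_loop_carrier:
  assumes "Q \<in> carrier_mat k k" "R \<in> carrier_mat k k" "P \<in> carrier_mat N N"
  shows "closed_loop Q R s N P \<in> carrier_mat (N * k) (N * k)"
  using assms unfolding closed_loop_def by auto

text \<open>
  \<open>X \<otimes> I\<close> commutes past \<open>I \<otimes> Q\<close> for any \<open>X\<close>, because the factors
  act on different tensor slots; past \<open>P \<otimes> R\<close> it moves by the relation between the
  coupling matrices.  Taking an eigenvector of \<open>P\<close> for \<open>X\<close>, as a column or as a row, gives
  the two relations between the network and one mode.
\<close>

lemma closed_loop_intertwine:
  assumes Q: "Q \<in> carrier_mat k k" and R: "R \<in> carrier_mat k k"
    and P: "P \<in> carrier_mat N N" and P': "P' \<in> carrier_mat N' N'"
    and X: "X \<in> carrier_mat N N'" and PX: "P * X = X * P'"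
  shows "closed_loop Q R s N P * (X \<otimes>\<^sub>k 1\<^sub>m k) = (X \<otimes>\<^sub>k 1\<^sub>m k) * closed_loop Q R s N' P'"
proof -
  let ?X = "X \<otimes>\<^sub>k 1\<^sub>m k :: complex mat"
  have Xc: "?X \<in> carrier_mat (N * k) (N' * k)" using X by auto
  have c: "s \<cdot>\<^sub>m 1\<^sub>m (N * k) \<in> carrier_mat (N * k) (N * k)" "1\<^sub>m N \<otimes>\<^sub>k Q \<in> carrier_mat (N * k) (N * k)"
    "P \<otimes>\<^sub>k R \<in> carrier_mat (N * k) (N * k)"
    "s \<cdot>\<^sub>m 1\<^sub>m (N' * k) \<in> carrier_mat (N' * k) (N' * k)" "1\<^sub>m N' \<otimes>\<^sub>k Q \<in> carrier_mat (N' * k) (N' * k)"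
    "P' \<otimes>\<^sub>k R \<in> carrier_mat (N' * k) (N' * k)"
    "s \<cdot>\<^sub>m 1\<^sub>m (N * k) - 1\<^sub>m N \<otimes>\<^sub>k Q \<in> carrier_mat (N * k) (N * k)"
    "s \<cdot>\<^sub>m 1\<^sub>m (N' * k) - 1\<^sub>m N' \<otimes>\<^sub>k Q \<in> carrier_mat (N' * k) (N' * k)"
    using Q R P P' by (auto intro!: kron_carrier)
  have 1: "s \<cdot>\<^sub>m 1\<^sub>m (N * k) * ?X = ?X * (s \<cdot>\<^sub>m 1\<^sub>m (N' * k))"
    using mult_smult_assoc_mat[OF one_carrier_mat Xc, of s] mult_smult_distrib[OF Xc one_carrier_mat, of s]
      left_mult_one_mat[OF Xc] right_mult_one_mat[OF Xc] by simp
  have 2: "(1\<^sub>m N \<otimes>\<^sub>k Q) * ?X = ?X * (1\<^sub>m N' \<otimes>\<^sub>k Q)"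
    using kron_mult[OF one_carrier_mat X Q one_carrier_mat] kron_mult[OF X one_carrier_mat one_carrier_mat Q]
      X Q by simp
  have 3: "(P \<otimes>\<^sub>k R) * ?X = ?X * (P' \<otimes>\<^sub>k R)"
    using kron_mult[OF P X R one_carrier_mat] kron_mult[OF X P' one_carrier_mat R] R PX by simp
  have "closed_loop Q R s N P * ?X
      = s \<cdot>\<^sub>m 1\<^sub>m (N * k) * ?X - (1\<^sub>m N \<otimes>\<^sub>k Q) * ?X - (P \<otimes>\<^sub>k R) * ?X"
    unfolding closed_loop_def using Q
    by (simp add: minus_mult_distrib_mat[OF c(7) c(3) Xc] minus_mult_distrib_mat[OF c(1) c(2) Xc])
  also have "\<dots> = ?X * (s \<cdot>\<^sub>m 1\<^sub>m (N' * k)) - ?X * (1\<^sub>m N' \<otimes>\<^sub>k Q) - ?X * (P' \<otimes>\<^sub>k R)"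
    unfolding 1 2 3 ..
  also have "\<dots> = ?X * closed_loop Q R s N' P'"
    unfolding closed_loop_def using Q
    by (simp add: mult_minus_distrib_mat[OF Xc c(8) c(6)] mult_minus_distrib_mat[OF Xc c(4) c(5)])
  finally show ?thesis .
qed

lemma mat_inv_intertwine:
  fixes A :: "complex mat"
  assumes A: "A \<in> carrier_mat n n" "det A \<noteq> 0" and A': "A' \<in> carrier_mat n' n'" "det A' \<noteq> 0"
    and X: "X \<in> carrier_mat n n'" and AX: "A * X = X * A'"
  shows "mat_inv A * X = X * mat_inv A'"
proof -
  note I = mat_inv[OF A] and I' = mat_inv[OF A']
  have "mat_inv A * X = mat_inv A * (X * (A' * mat_inv A'))"
    using I' X by simp
  also have "X * (A' * mat_inv A') = (A * X) * mat_inv A'"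
    using assoc_mult_mat[OF X A'(1) I'(1)] AX by simp
  also have "\<dots> = A * (X * mat_inv A')"
    by (rule assoc_mult_mat[OF A(1) X I'(1)])
  also have "mat_inv A * \<dots> = (mat_inv A * A) * (X * mat_inv A')"
    by (rule assoc_mult_mat[symmetric, OF I(1) A(1)]) (use X I' in auto)
  also have "\<dots> = X * mat_inv A'"
    unfolding I(3) by (rule left_mult_one_mat[OF mult_carrier_mat[OF X I'(1)]])
  finally show ?thesis .
qed

lemma coupled_transfer_carrier:
  assumes "Q \<in> carrier_mat k k" "R \<in> carrier_mat k k" "C \<in> carrier_mat p k" "B \<in> carrier_mat k m"
    and "P \<in> carrier_mat N N" and "det (closed_loop Q R s N P) \<noteq> 0"
  shows "coupled_transfer C B Q R s N P \<in> carrier_mat (N * p) (N * m)"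
  unfolding coupled_transfer_def
  using mat_inv_carrier[OF closed_loop_carrier[OF assms(1,2,5)] assms(6)] assms(3,4)
  by auto

lemma coupled_transfer_intertwine:
  assumes Q: "Q \<in> carrier_mat k k" and R: "R \<in> carrier_mat k k"
    and C: "C \<in> carrier_mat p k" and B: "B \<in> carrier_mat k m"
    and P: "P \<in> carrier_mat N N" "det (closed_loop Q R s N P) \<noteq> 0"
    and P': "P' \<in> carrier_mat N' N'" "det (closed_loop Q R s N' P') \<noteq> 0"
    and X: "X \<in> carrier_mat N N'" and PX: "P * X = X * P'"
  shows "coupled_transfer C B Q R s N P * (X \<otimes>\<^sub>k 1\<^sub>m m) = (X \<otimes>\<^sub>k 1\<^sub>m p) * coupled_transfer C B Q R s N' P'"
proof -
  let ?M = "closed_loop Q R s N P" and ?M' = "closed_loop Q R s N' P'"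
  let ?X = "\<lambda>k. X \<otimes>\<^sub>k 1\<^sub>m k :: complex mat"
  let ?C = "\<lambda>N. 1\<^sub>m N \<otimes>\<^sub>k C :: complex mat" and ?B = "\<lambda>N. 1\<^sub>m N \<otimes>\<^sub>k B :: complex mat"
  have Xc: "?X k \<in> carrier_mat (N * k) (N' * k)" for k using X by auto
  have Cc: "?C N \<in> carrier_mat (N * p) (N * k)" and Bc: "?B N \<in> carrier_mat (N * k) (N * m)" for N
    using C B by auto
  note M = closed_loop_carrier[OF Q R P(1), of s] and M' = closed_loop_carrier[OF Q R P'(1), of s]
  note I = mat_inv_carrier[OF M P(2)] and I' = mat_inv_carrier[OF M' P'(2)]
  have inv: "mat_inv ?M * ?X k = ?X k * mat_inv ?M'"
    by (rule mat_inv_intertwine[OF M P(2) M' P'(2) Xc closed_loop_intertwine[OF Q R P(1) P'(1) X PX]])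
  have BX: "?B N * ?X m = ?X k * ?B N'"
    using kron_mult[OF one_carrier_mat X B one_carrier_mat] kron_mult[OF X one_carrier_mat one_carrier_mat B]
      X B by simp
  have CX: "?C N * ?X k = ?X p * ?C N'"
    using kron_mult[OF one_carrier_mat X C one_carrier_mat] kron_mult[OF X one_carrier_mat one_carrier_mat C]
      X C by simp
  have "coupled_transfer C B Q R s N P * ?X m = ?C N * mat_inv ?M * (?X k * ?B N')"
    unfolding coupled_transfer_def BX[symmetric]
    by (rule assoc_mult_mat[OF mult_carrier_mat[OF Cc I] Bc Xc])
  also have "\<dots> = ?C N * (mat_inv ?M * (?X k * ?B N'))"
    by (rule assoc_mult_mat[OF Cc I mult_carrier_mat[OF Xc Bc]])
  also have "mat_inv ?M * (?X k * ?B N') = ?X k * mat_inv ?M' * ?B N'"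
    using assoc_mult_mat[OF I Xc Bc] inv by simp
  also have "\<dots> = ?X k * (mat_inv ?M' * ?B N')"
    by (rule assoc_mult_mat[OF Xc I' Bc])
  also have "?C N * \<dots> = (?X p * ?C N') * (mat_inv ?M' * ?B N')"
    using assoc_mult_mat[OF Cc Xc mult_carrier_mat[OF I' Bc]] CX by simp
  also have "\<dots> = ?X p * (?C N' * (mat_inv ?M' * ?B N'))"
    by (rule assoc_mult_mat[OF Xc Cc mult_carrier_mat[OF I' Bc]])
  also have "?C N' * (mat_inv ?M' * ?B N') = coupled_transfer C B Q R s N' P'"
    unfolding coupled_transfer_def by (rule assoc_mult_mat[OF Cc I' Bc, symmetric])
  finally show ?thesis .
qed

text \<open>
  Column \<open>i\<close> as a matrix with one column, so that it can be a factor of a Kronecker product.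
\<close>

definition mode :: "complex mat \<Rightarrow> nat \<Rightarrow> complex mat" where
  "mode U i = mat (dim_row U) 1 (\<lambda>(j, _). U $$ (j, i))"

abbreviation scalar_mat :: "complex \<Rightarrow> complex mat" where
  "scalar_mat d \<equiv> mat 1 1 (\<lambda>_. d)"

lemma dim_mode [simp]: "dim_row (mode U i) = dim_row U" "dim_col (mode U i) = 1"
  by (auto simp: mode_def)

lemma mode_carrier [simp]: "U \<in> carrier_mat N N \<Longrightarrow> mode U i \<in> carrier_mat N 1"
  by (auto simp: mode_def)

lemma mode_eigen:
  assumes U: "U \<in> carrier_mat N N" and D: "D \<in> carrier_mat N N" and P: "P \<in> carrier_mat N N"
    and diag: "diagonal_mat D" and PU: "P * U = U * D" and i: "i < N"
  shows "P * mode U i = mode U i * scalar_mat (D $$ (i, i))"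
proof (rule eq_matI)
  fix j l assume "j < dim_row (mode U i * scalar_mat (D $$ (i, i)))" "l < dim_col (mode U i * scalar_mat (D $$ (i, i)))"
  then have j: "j < N" "l = 0" using U by (auto simp: mode_def)
  have "(P * mode U i) $$ (j, l) = (P * U) $$ (j, i)"
    using U P i j by (simp add: scalar_prod_def mode_def)
  also have "\<dots> = (\<Sum>q\<in>{0..<N}. U $$ (j, q) * D $$ (q, i))"
    unfolding PU using U D i j by (simp add: scalar_prod_def)
  also have "\<dots> = (\<Sum>q\<in>{i}. U $$ (j, q) * D $$ (q, i))"
    by (rule sum.mono_neutral_right) (use diag D i in \<open>auto simp: diagonal_mat_def\<close>)
  also have "\<dots> = (mode U i * scalar_mat (D $$ (i, i))) $$ (j, l)"
    using U i j by (simp add: scalar_prod_def mode_def)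
  finally show "(P * mode U i) $$ (j, l) = (mode U i * scalar_mat (D $$ (i, i))) $$ (j, l)" .
qed (use P U in \<open>auto simp: mode_def\<close>)

lemma adjoint_mode_eigen:
  assumes U: "U \<in> carrier_mat N N" and D: "D \<in> carrier_mat N N" and P: "P \<in> carrier_mat N N"
    and diag: "diagonal_mat D" and VP: "mat_adjoint U * P = D * mat_adjoint U" and i: "i < N"
  shows "scalar_mat (D $$ (i, i)) * mat_adjoint (mode U i) = mat_adjoint (mode U i) * P"
proof (rule eq_matI)
  let ?V = "mat_adjoint U"
  have V: "?V \<in> carrier_mat N N" using U by simp
  have vm: "mat_adjoint (mode U i) $$ (0, q) = ?V $$ (i, q)" if "q < N" for q
    using that U i by (simp add: mode_def mat_adjoint_index)
  fix j l assume "j < dim_row (mat_adjoint (mode U i) * P)" "l < dim_col (mat_adjoint (mode U i) * P)"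
  then have j: "j = 0" "l < N" using U P by (auto simp: mode_def)
  have "(mat_adjoint (mode U i) * P) $$ (j, l) = (?V * P) $$ (i, l)"
    using U P i j by (simp add: scalar_prod_def vm)
  also have "\<dots> = (\<Sum>q\<in>{0..<N}. D $$ (i, q) * ?V $$ (q, l))"
    unfolding VP using V U D i j by (simp add: scalar_prod_def)
  also have "\<dots> = (\<Sum>q\<in>{i}. D $$ (i, q) * ?V $$ (q, l))"
    by (rule sum.mono_neutral_right) (use diag D i in \<open>auto simp: diagonal_mat_def\<close>)
  also have "\<dots> = (scalar_mat (D $$ (i, i)) * mat_adjoint (mode U i)) $$ (j, l)"
    using U i j by (simp add: scalar_prod_def vm)
  finally show "(scalar_mat (D $$ (i, i)) * mat_adjoint (mode U i)) $$ (j, l)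
    = (mat_adjoint (mode U i) * P) $$ (j, l)" by simp
qed (use P U in \<open>auto simp: mode_def\<close>)

lemma adjoint_mode_times_mode:
  assumes U: "U \<in> carrier_mat N N" and VU: "mat_adjoint U * U = 1\<^sub>m N" and i: "i < N"
  shows "mat_adjoint (mode U i) * mode U i = 1\<^sub>m 1"
proof -
  have "(mat_adjoint (mode U i) * mode U i) $$ (0, 0) = (mat_adjoint U * U) $$ (i, i)"
    using U i by (simp add: scalar_prod_def mode_def mat_adjoint_index)
  also have "\<dots> = 1" using VU i by simp
  finally show ?thesis using U by (intro eq_matI) (auto simp: mode_def)
qed

text \<open>
  The modal components of a stacked vector determine it, since together they are its image under
  the unitary matrix \<open>U\<^sup>* \<otimes> I\<close>.
\<close>

lemma modes_separate:
  assumes U: "U \<in> carrier_mat N N" and UV: "U * mat_adjoint U = 1\<^sub>m N"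
    and y: "y \<in> carrier_vec (N * k)"
    and 0: "\<And>i. i < N \<Longrightarrow> (mat_adjoint (mode U i) \<otimes>\<^sub>k 1\<^sub>m k) *\<^sub>v y = 0\<^sub>v k"
  shows "y = 0\<^sub>v (N * k)"
proof -
  let ?V = "mat_adjoint U"
  have V: "?V \<in> carrier_mat N N" using U by simp
  have c: "?V \<otimes>\<^sub>k 1\<^sub>m k \<in> carrier_mat (N * k) (N * k)" "U \<otimes>\<^sub>k 1\<^sub>m k \<in> carrier_mat (N * k) (N * k)"
    using U V by auto
  have "(?V \<otimes>\<^sub>k 1\<^sub>m k) *\<^sub>v y = 0\<^sub>v (N * k)"
  proof (rule eq_vecI)
    fix t assume "t < dim_vec (0\<^sub>v (N * k) :: complex vec)"
    then have t: "t < N * k" by simp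
    note b = div_mod_bounds[OF t]
    have "((?V \<otimes>\<^sub>k 1\<^sub>m k) *\<^sub>v y) $ t = ((mat_adjoint (mode U (t div k)) \<otimes>\<^sub>k 1\<^sub>m k) *\<^sub>v y) $ (t mod k)"
      using U y t b
      by (auto simp: scalar_prod_def kron_index mode_def mat_adjoint_index div_mod_bounds intro!: sum.cong)
    also have "\<dots> = 0" using 0[OF b(1)] b(2) by (metis index_zero_vec(1))
    finally show "((?V \<otimes>\<^sub>k 1\<^sub>m k) *\<^sub>v y) $ t = 0\<^sub>v (N * k) $ t" using t by simp
  qed (use U in auto)
  moreover have "(U \<otimes>\<^sub>k 1\<^sub>m k) *\<^sub>v ((?V \<otimes>\<^sub>k 1\<^sub>m k) *\<^sub>v y) = y"
  proof -
    have "(U \<otimes>\<^sub>k 1\<^sub>m k) * (?V \<otimes>\<^sub>k 1\<^sub>m k) = 1\<^sub>m N \<otimes>\<^sub>k (1\<^sub>m k :: complex mat)"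
      using kron_mult[OF U V one_carrier_mat one_carrier_mat] UV by simp
    also have "\<dots> = 1\<^sub>m (N * k)"
    proof (rule eq_matI)
      fix i j assume ij: "i < dim_row (1\<^sub>m (N * k) :: complex mat)" "j < dim_col (1\<^sub>m (N * k) :: complex mat)"
      have "i div k = j div k \<and> i mod k = j mod k \<longleftrightarrow> i = j" by (metis div_mult_mod_eq)
      then show "(1\<^sub>m N \<otimes>\<^sub>k 1\<^sub>m k) $$ (i, j) = (1\<^sub>m (N * k) :: complex mat) $$ (i, j)"
        using ij by (auto simp: kron_index div_mod_bounds)
    qed auto
    finally show ?thesis using assoc_mult_mat_vec[OF c(2,1) y] y by simp
  qed
  moreover have "(U \<otimes>\<^sub>k 1\<^sub>m k) *\<^sub>v 0\<^sub>v (N * k) = 0\<^sub>v (N * k)"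
    using U by (intro eq_vecI) auto
  ultimately show ?thesis by simp
qed

text \<open>
  Every modal component of a kernel vector lies in the kernel of the characteristic matrix of that
  mode, so it vanishes.
\<close>

lemma closed_loop_nonsingular_if_modes:
  assumes Q: "Q \<in> carrier_mat k k" and R: "R \<in> carrier_mat k k"
    and U: "U \<in> carrier_mat N N" and D: "D \<in> carrier_mat N N" and P: "P \<in> carrier_mat N N"
    and diag: "diagonal_mat D" and UV: "U * mat_adjoint U = 1\<^sub>m N"
    and VP: "mat_adjoint U * P = D * mat_adjoint U"
    and ns: "\<And>i. i < N \<Longrightarrow> det (closed_loop Q R s 1 (scalar_mat (D $$ (i, i)))) \<noteq> 0"
  shows "det (closed_loop Q R s N P) \<noteq> 0"
proof
  let ?M = "closed_loop Q R s N P"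
  have M: "?M \<in> carrier_mat (N * k) (N * k)" by (rule closed_loop_carrier[OF Q R P])
  assume "det ?M = 0"
  then obtain y where y: "y \<in> carrier_vec (N * k)" "y \<noteq> 0\<^sub>v (N * k)" and My: "?M *\<^sub>v y = 0\<^sub>v (N * k)"
    using det_0_iff_vec_prod_zero[OF M] by blast
  have "(mat_adjoint (mode U i) \<otimes>\<^sub>k 1\<^sub>m k) *\<^sub>v y = 0\<^sub>v k" if i: "i < N" for i
  proof -
    let ?S = "scalar_mat (D $$ (i, i))" and ?r = "mat_adjoint (mode U i)"
    let ?Mi = "closed_loop Q R s 1 ?S" and ?X = "?r \<otimes>\<^sub>k 1\<^sub>m k :: complex mat"
    have S: "?S \<in> carrier_mat 1 1" by simp
    have r: "?r \<in> carrier_mat 1 N" by (rule mat_adjoint_carrier[OF mode_carrier[OF U]])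
    have X: "?X \<in> carrier_mat k (N * k)" using kron_carrier[OF r one_carrier_mat, of k] by simp
    have Mi: "?Mi \<in> carrier_mat k k" using closed_loop_carrier[OF Q R S, of s] by simp
    have "?Mi * ?X = ?X * ?M"
      by (rule closed_loop_intertwine[OF Q R S P r adjoint_mode_eigen[OF U D P diag VP i]])
    then have "?Mi *\<^sub>v (?X *\<^sub>v y) = ?X *\<^sub>v (?M *\<^sub>v y)"
      using assoc_mult_mat_vec[OF Mi X y(1)] assoc_mult_mat_vec[OF X M y(1)] by simp
    also have "\<dots> = 0\<^sub>v k" using X My by auto
    finally show ?thesis
      using ns[OF i] det_0_iff_vec_prod_zero[OF Mi] mult_mat_vec_carrier[OF X y(1)] by blast
  qed
  then show False using modes_separate[OF U UV y(1)] y(2) by blast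
qed

lemma mat_adjoint_gram: "mat_adjoint (mat_adjoint A * A) = mat_adjoint A * (A :: complex mat)"
  by (subst mat_adjoint_mult[of _ "dim_col A" "dim_row A" _ "dim_col A"]) auto

text \<open>
  Taking adjoints in the relation for \<open>Y\<^sup>* T\<close> moves \<open>T\<^sup>*\<close> past \<open>Y\<close>.
\<close>

lemma gram_intertwine:
  fixes T :: "complex mat"
  assumes T: "T \<in> carrier_mat p m" and T': "T' \<in> carrier_mat p' m'"
    and X: "X \<in> carrier_mat m m'" and Y: "Y \<in> carrier_mat p p'"
    and TX: "T * X = Y * T'" and YT: "mat_adjoint Y * T = T' * mat_adjoint X"
  shows "(mat_adjoint T * T) * X = X * (mat_adjoint T' * T')"
proof -
  have a: "mat_adjoint T \<in> carrier_mat m p" "mat_adjoint T' \<in> carrier_mat m' p'"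
    using T T' by auto
  have "mat_adjoint T * Y = X * mat_adjoint T'"
    using arg_cong[OF YT, of mat_adjoint] T T' X Y
      mat_adjoint_mult[of "mat_adjoint Y" p' p T m] mat_adjoint_mult[of T' p' m' "mat_adjoint X" m]
    by simp
  then show ?thesis
    using assoc_mult_mat[OF a(1) T X] assoc_mult_mat[OF a(1) Y T'] assoc_mult_mat[OF X a(2) T'] TX
    by simp
qed

text \<open>
  The heart of the comparison.  The Gram matrix of the network intertwines with the Gram matrix
  of each mode in both directions.  Hence an eigenvector of a mode lifts to the network, and an
  eigenvector of the network has a nonzero component in some mode, which is an eigenvector there
  for the same eigenvalue.  The left relations need \<open>U\<close> to be unitary: only then
  are the rows of the inverse of \<open>U\<close> the adjoints of its columns.
\<close>

theorem singular_values_coupled_transfer: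
  assumes Q: "Q \<in> carrier_mat k k" and R: "R \<in> carrier_mat k k"
    and C: "C \<in> carrier_mat p k" and B: "B \<in> carrier_mat k m"
    and U: "U \<in> carrier_mat N N" and D: "D \<in> carrier_mat N N" and P: "P \<in> carrier_mat N N"
    and diag: "diagonal_mat D" and UV: "U * mat_adjoint U = 1\<^sub>m N" and VU: "mat_adjoint U * U = 1\<^sub>m N"
    and PU: "P * U = U * D" and VP: "mat_adjoint U * P = D * mat_adjoint U"
    and ns: "\<And>i. i < N \<Longrightarrow> det (closed_loop Q R s 1 (scalar_mat (D $$ (i, i)))) \<noteq> 0"
  shows "singular_values (coupled_transfer C B Q R s N P)
    = (\<Union>i<N. singular_values (coupled_transfer C B Q R s 1 (scalar_mat (D $$ (i, i)))))"
proof -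
  let ?T = "coupled_transfer C B Q R s N P"
  let ?S = "\<lambda>i. scalar_mat (D $$ (i, i))"
  let ?Ti = "\<lambda>i. coupled_transfer C B Q R s 1 (?S i)"
  let ?G = "mat_adjoint ?T * ?T" and ?Gi = "\<lambda>i. mat_adjoint (?Ti i) * ?Ti i"
  let ?X = "\<lambda>i. mode U i \<otimes>\<^sub>k 1\<^sub>m m :: complex mat"
  note det = closed_loop_nonsingular_if_modes[OF Q R U D P diag UV VP ns]
  have T: "?T \<in> carrier_mat (N * p) (N * m)"
    by (rule coupled_transfer_carrier[OF Q R C B P det])
  have G: "?G \<in> carrier_mat (N * m) (N * m)"
    using T mat_adjoint_carrier[OF T] by auto
  have S: "?S i \<in> carrier_mat 1 1" for i by simp
  have Ti: "?Ti i \<in> carrier_mat p m" if "i < N" for i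
    using coupled_transfer_carrier[OF Q R C B S ns[OF that]] by simp
  have Gi: "?Gi i \<in> carrier_mat m m" if "i < N" for i
    using Ti[OF that] mat_adjoint_carrier[OF Ti[OF that]] by auto
  have X: "mode U i \<otimes>\<^sub>k 1\<^sub>m l \<in> carrier_mat (N * l) l" for i l
    using kron_carrier[OF mode_carrier[OF U] one_carrier_mat, of i l] by simp
  have X': "mat_adjoint (mode U i \<otimes>\<^sub>k 1\<^sub>m l) = mat_adjoint (mode U i) \<otimes>\<^sub>k 1\<^sub>m l" for i l
    by (simp add: mat_adjoint_kron)
  have GX: "?G * ?X i = ?X i * ?Gi i" if i: "i < N" for i
  proof (rule gram_intertwine[OF T Ti[OF i] X X])
    show "?T * ?X i = (mode U i \<otimes>\<^sub>k 1\<^sub>m p) * ?Ti i"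
      by (rule coupled_transfer_intertwine[OF Q R C B P det S ns[OF i] mode_carrier[OF U]
            mode_eigen[OF U D P diag PU i]])
    show "mat_adjoint (mode U i \<otimes>\<^sub>k 1\<^sub>m p) * ?T = ?Ti i * mat_adjoint (?X i)"
      unfolding X'
      by (rule coupled_transfer_intertwine[symmetric, OF Q R C B S ns[OF i] P det
            mat_adjoint_carrier[OF mode_carrier[OF U]] adjoint_mode_eigen[OF U D P diag VP i]])
  qed
  have XG: "mat_adjoint (?X i) * ?G = ?Gi i * mat_adjoint (?X i)" if i: "i < N" for i
  proof -
    have "mat_adjoint (?X i) * mat_adjoint ?G = mat_adjoint (?G * ?X i)"
      by (rule mat_adjoint_mult[OF G X, symmetric])
    also have "\<dots> = mat_adjoint (?Gi i) * mat_adjoint (?X i)"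
      unfolding GX[OF i] by (rule mat_adjoint_mult[OF X Gi[OF i]])
    finally show ?thesis unfolding mat_adjoint_gram .
  qed
  have "eigenvalue ?G e \<longleftrightarrow> (\<exists>i<N. eigenvalue (?Gi i) e)" for e
  proof
    assume "eigenvalue ?G e"
    then obtain y where y: "y \<in> carrier_vec (N * m)" "y \<noteq> 0\<^sub>v (N * m)" and Gy: "?G *\<^sub>v y = e \<cdot>\<^sub>v y"
      unfolding eigenvalue_def eigenvector_def using G by auto
    from modes_separate[OF U UV y(1)] y(2) obtain i where i: "i < N"
      and nz: "mat_adjoint (?X i) *\<^sub>v y \<noteq> 0\<^sub>v m" unfolding X' by blast
    have Xa: "mat_adjoint (?X i) \<in> carrier_mat m (N * m)" by (rule mat_adjoint_carrier[OF X])
    have "?Gi i *\<^sub>v (mat_adjoint (?X i) *\<^sub>v y) = (?Gi i * mat_adjoint (?X i)) *\<^sub>v y"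
      by (rule assoc_mult_mat_vec[symmetric, OF Gi[OF i] Xa y(1)])
    also have "\<dots> = mat_adjoint (?X i) *\<^sub>v (?G *\<^sub>v y)"
      unfolding XG[OF i, symmetric] by (rule assoc_mult_mat_vec[OF Xa G y(1)])
    also have "\<dots> = e \<cdot>\<^sub>v (mat_adjoint (?X i) *\<^sub>v y)"
      unfolding Gy by (rule mult_mat_vec[OF Xa y(1)])
    finally show "\<exists>i<N. eigenvalue (?Gi i) e"
      unfolding eigenvalue_def eigenvector_def
      using nz i carrier_matD(1)[OF Gi[OF i]] mult_mat_vec_carrier[OF Xa y(1)] by auto
  next
    assume "\<exists>i<N. eigenvalue (?Gi i) e"
    then obtain i where i: "i < N" and "eigenvalue (?Gi i) e" by blast
    then obtain v where v: "v \<in> carrier_vec m" "v \<noteq> 0\<^sub>v m" and Gv: "?Gi i *\<^sub>v v = e \<cdot>\<^sub>v v"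
      unfolding eigenvalue_def eigenvector_def using carrier_matD(1)[OF Gi[OF i]] by auto
    have "?G *\<^sub>v (?X i *\<^sub>v v) = (?G * ?X i) *\<^sub>v v"
      by (rule assoc_mult_mat_vec[symmetric, OF G X v(1)])
    also have "\<dots> = ?X i *\<^sub>v (?Gi i *\<^sub>v v)"
      unfolding GX[OF i] by (rule assoc_mult_mat_vec[OF X Gi[OF i] v(1)])
    also have "\<dots> = e \<cdot>\<^sub>v (?X i *\<^sub>v v)"
      unfolding Gv by (rule mult_mat_vec[OF X v(1)])
    finally have 1: "?G *\<^sub>v (?X i *\<^sub>v v) = e \<cdot>\<^sub>v (?X i *\<^sub>v v)" .
    have "mat_adjoint (?X i) * ?X i = 1\<^sub>m 1 \<otimes>\<^sub>k (1\<^sub>m m :: complex mat)"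
      unfolding X'
      using kron_mult[OF mat_adjoint_carrier[OF mode_carrier[OF U]] mode_carrier[OF U] one_carrier_mat one_carrier_mat]
        adjoint_mode_times_mode[OF U VU i] by simp
    also have "\<dots> = 1\<^sub>m m"
      by (rule eq_matI) (auto simp: kron_index)
    finally have XX: "mat_adjoint (?X i) * ?X i = 1\<^sub>m m" .
    have "mat_adjoint (?X i) *\<^sub>v (?X i *\<^sub>v v) = (mat_adjoint (?X i) * ?X i) *\<^sub>v v"
      by (rule assoc_mult_mat_vec[symmetric, OF mat_adjoint_carrier[OF X] X v(1)])
    also have "\<dots> = v" unfolding XX using v(1) by simp
    finally have "mat_adjoint (?X i) *\<^sub>v (?X i *\<^sub>v v) = v" .
    moreover have "mat_adjoint (?X i) *\<^sub>v 0\<^sub>v (N * m) = 0\<^sub>v m"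
      using mat_adjoint_carrier[OF X, of i m] by auto
    ultimately have "?X i *\<^sub>v v \<noteq> 0\<^sub>v (N * m)" using v(2) by auto
    with 1 show "eigenvalue ?G e"
      unfolding eigenvalue_def eigenvector_def
      using carrier_matD(1)[OF G] mult_mat_vec_carrier[OF X v(1)] by auto
  qed
  then show ?thesis unfolding singular_values_def by auto
qed

section \<open>Exponential stability excludes imaginary characteristic roots\<close>

text \<open>
  The coefficient matrices of the exponentials in \<open>Q_mat\<close> and \<open>R_mat\<close>, named after the
  delay that they belong to.
\<close>

definition block_Q0 :: "'p network_data \<Rightarrow> 'p \<Rightarrow> real mat" where
  "block_Q0 S p = four_block_mat (mat_A S 0) (0\<^sub>m (dim_x S) (dim_xi S)) (mat_F S p * mat_Cy S) (mat_J S p)"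

definition block_A :: "'p network_data \<Rightarrow> nat \<Rightarrow> real mat" where
  "block_A S k = four_block_mat (mat_A S k) (0\<^sub>m (dim_x S) (dim_xi S))
     (0\<^sub>m (dim_xi S) (dim_x S)) (0\<^sub>m (dim_xi S) (dim_xi S))"

definition block_u :: "'p network_data \<Rightarrow> 'p \<Rightarrow> real mat" where
  "block_u S p = four_block_mat (mat_Bu S * mat_K S p * mat_Cy S) (mat_Bu S * mat_L S p)
     (0\<^sub>m (dim_xi S) (dim_x S)) (0\<^sub>m (dim_xi S) (dim_xi S))"

definition block_n :: "'p network_data \<Rightarrow> real mat" where
  "block_n S = four_block_mat (mat_Bun S * mat_Cyn S) (0\<^sub>m (dim_x S) (dim_xi S))
     (0\<^sub>m (dim_xi S) (dim_x S)) (0\<^sub>m (dim_xi S) (dim_xi S))"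

definition block_u_nc :: "'p network_data \<Rightarrow> 'p \<Rightarrow> real mat" where
  "block_u_nc S p = four_block_mat (mat_Bu S * mat_Kn S p * mat_Cy S) (0\<^sub>m (dim_x S) (dim_xi S))
     (0\<^sub>m (dim_xi S) (dim_x S)) (0\<^sub>m (dim_xi S) (dim_xi S))"

definition block_nc :: "'p network_data \<Rightarrow> 'p \<Rightarrow> real mat" where
  "block_nc S p = four_block_mat (0\<^sub>m (dim_x S) (dim_x S)) (0\<^sub>m (dim_x S) (dim_xi S))
     (mat_Fn S p * mat_Cy S) (0\<^sub>m (dim_xi S) (dim_xi S))"

abbreviation dim_state :: "'p network_data \<Rightarrow> nat" where
  "dim_state S \<equiv> dim_x S + dim_xi S"

lemma block_carrier:
  assumes "wf_data S p"
  shows "block_Q0 S p \<in> carrier_mat (dim_state S) (dim_state S)"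
    and "k \<le> num_delays S \<Longrightarrow> block_A S k \<in> carrier_mat (dim_state S) (dim_state S)"
    and "block_u S p \<in> carrier_mat (dim_state S) (dim_state S)"
    and "block_n S \<in> carrier_mat (dim_state S) (dim_state S)"
    and "block_u_nc S p \<in> carrier_mat (dim_state S) (dim_state S)"
    and "block_nc S p \<in> carrier_mat (dim_state S) (dim_state S)"
  using assms unfolding wf_data_def block_Q0_def block_A_def block_u_def block_n_def block_u_nc_def block_nc_def
  by auto

lemma Q_mat_blocks:
  "Q_mat S p s = cmat (block_Q0 S p)
    + mat_sum (dim_state S) (dim_state S) (\<lambda>k. exp (- s * complex_of_real (tau S k)) \<cdot>\<^sub>m cmat (block_A S k))
        {1..num_delays S}
    + exp (- s * complex_of_real (tau_u S)) \<cdot>\<^sub>m cmat (block_u S p)"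
  by (simp add: Q_mat_def Let_def block_Q0_def block_A_def block_u_def)

lemma R_mat_blocks:
  "R_mat S p s = exp (- s * complex_of_real (tau_n S)) \<cdot>\<^sub>m cmat (block_n S)
    + exp (- s * complex_of_real (tau_u S + tau_nc S)) \<cdot>\<^sub>m cmat (block_u_nc S p)
    + exp (- s * complex_of_real (tau_nc S)) \<cdot>\<^sub>m cmat (block_nc S p)"
  by (simp add: R_mat_def Let_def block_n_def block_u_nc_def block_nc_def)

lemma Q_mat_carrier: "wf_data S p \<Longrightarrow> Q_mat S p s \<in> carrier_mat (dim_state S) (dim_state S)"
  unfolding Q_mat_blocks by (auto dest: block_carrier)

lemma R_mat_carrier: "wf_data S p \<Longrightarrow> R_mat S p s \<in> carrier_mat (dim_state S) (dim_state S)"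
  unfolding R_mat_blocks by (auto dest: block_carrier)

lemma Q_mat_index:
  assumes wf: "wf_data S p" and i: "i < dim_state S" and j: "j < dim_state S"
  shows "Q_mat S p s $$ (i, j) = complex_of_real (block_Q0 S p $$ (i, j))
    + (\<Sum>k=1..num_delays S. exp (- s * complex_of_real (tau S k)) * complex_of_real (block_A S k $$ (i, j)))
    + exp (- s * complex_of_real (tau_u S)) * complex_of_real (block_u S p $$ (i, j))"
proof -
  have "(e \<cdot>\<^sub>m cmat (block_A S k)) $$ (i, j) = e * complex_of_real (block_A S k $$ (i, j))"
    if "k \<in> {1..num_delays S}" for e k
    using that i j block_carrier(2)[OF wf, of k] by auto
  then show ?thesis
    unfolding Q_mat_blocks mat_sum_def using i j block_carrier[OF wf] by simp
qed

lemma R_mat_index: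
  assumes wf: "wf_data S p" and i: "i < dim_state S" and j: "j < dim_state S"
  shows "R_mat S p s $$ (i, j) = exp (- s * complex_of_real (tau_n S)) * complex_of_real (block_n S $$ (i, j))
    + exp (- s * complex_of_real (tau_u S + tau_nc S)) * complex_of_real (block_u_nc S p $$ (i, j))
    + exp (- s * complex_of_real (tau_nc S)) * complex_of_real (block_nc S p $$ (i, j))"
  unfolding R_mat_blocks using i j block_carrier[OF wf] by auto

text \<open>
  For \<open>z = cis (\<omega> t)\<close> this is the value at time \<open>t\<close> of the real solution that
  belongs to the complex mode \<open>v\<close>; a delay only multiplies \<open>z\<close> by an exponential.
\<close>

definition re_part :: "complex \<Rightarrow> complex vec \<Rightarrow> real vec" where
  "re_part z v = vec (dim_vec v) (\<lambda>i. Re (z * v $ i))"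

lemma dim_re_part [simp]: "dim_vec (re_part z v) = dim_vec v"
  by (simp add: re_part_def)

lemma re_part_append: "re_part z (v @\<^sub>v w) = re_part z v @\<^sub>v re_part z w"
  by (rule eq_vecI) (auto simp: re_part_def)

lemma mult_re_part_nth:
  assumes "A \<in> carrier_mat r k" "v \<in> carrier_vec k" "i < r"
  shows "(A *\<^sub>v re_part z v) $ i = Re (z * (cmat A *\<^sub>v v) $ i)"
  using assms by (simp add: scalar_prod_def re_part_def sum_distrib_left algebra_simps)

lemma four_block_mult_re_part_nth:
  assumes "A \<in> carrier_mat n n" "B \<in> carrier_mat n c" "C \<in> carrier_mat c n" "D \<in> carrier_mat c c"
    and "u \<in> carrier_vec n" "v \<in> carrier_vec c"
  shows "i < n \<Longrightarrow> (four_block_mat A B C D *\<^sub>v re_part z (u @\<^sub>v v)) $ i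
      = (A *\<^sub>v re_part z u) $ i + (B *\<^sub>v re_part z v) $ i"
    and "i < c \<Longrightarrow> (four_block_mat A B C D *\<^sub>v re_part z (u @\<^sub>v v)) $ (n + i)
      = (C *\<^sub>v re_part z u) $ i + (D *\<^sub>v re_part z v) $ i"
proof -
  have r: "re_part z u \<in> carrier_vec n" "re_part z v \<in> carrier_vec c"
    using assms by (auto simp: re_part_def)
  note eq = four_block_mat_mult_vec[OF assms(1-4) r]
  show "i < n \<Longrightarrow> (four_block_mat A B C D *\<^sub>v re_part z (u @\<^sub>v v)) $ i
      = (A *\<^sub>v re_part z u) $ i + (B *\<^sub>v re_part z v) $ i"
    unfolding re_part_append eq using assms by auto
  show "i < c \<Longrightarrow> (four_block_mat A B C D *\<^sub>v re_part z (u @\<^sub>v v)) $ (n + i)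
      = (C *\<^sub>v re_part z u) $ i + (D *\<^sub>v re_part z v) $ i"
    unfolding re_part_append eq using assms by auto
qed

lemma Re_Q_mat_mult:
  assumes wf: "wf_data S p" and u: "u \<in> carrier_vec (dim_state S)" and i: "i < dim_state S"
  shows "Re (z * (Q_mat S p s *\<^sub>v u) $ i) = (block_Q0 S p *\<^sub>v re_part z u) $ i
    + (\<Sum>k=1..num_delays S. (block_A S k *\<^sub>v re_part (z * exp (- s * complex_of_real (tau S k))) u) $ i)
    + (block_u S p *\<^sub>v re_part (z * exp (- s * complex_of_real (tau_u S))) u) $ i"
proof -
  let ?n = "dim_state S" and ?e = "\<lambda>t. exp (- s * complex_of_real t)"
  note bc = block_carrier[OF wf]
  have m: "(cmat A *\<^sub>v u) $ i = (\<Sum>j<?n. complex_of_real (A $$ (i, j)) * u $ j)"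
    if "A \<in> carrier_mat ?n ?n" for A
    using that u i by (simp add: scalar_prod_def lessThan_atLeast0)
  have "(Q_mat S p s *\<^sub>v u) $ i = (\<Sum>j<?n. Q_mat S p s $$ (i, j) * u $ j)"
    using Q_mat_carrier[OF wf, of s] u i by (simp add: scalar_prod_def lessThan_atLeast0)
  also have "\<dots> = (\<Sum>j<?n. complex_of_real (block_Q0 S p $$ (i, j)) * u $ j
      + (\<Sum>k=1..num_delays S. ?e (tau S k) * (complex_of_real (block_A S k $$ (i, j)) * u $ j))
      + ?e (tau_u S) * (complex_of_real (block_u S p $$ (i, j)) * u $ j))"
    by (intro sum.cong refl) (simp add: Q_mat_index[OF wf i] distrib_right sum_distrib_right mult.assoc)
  also have "\<dots> = (cmat (block_Q0 S p) *\<^sub>v u) $ i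
      + (\<Sum>k=1..num_delays S. ?e (tau S k) * (cmat (block_A S k) *\<^sub>v u) $ i)
      + ?e (tau_u S) * (cmat (block_u S p) *\<^sub>v u) $ i"
    by (simp add: sum.distrib sum_distrib_left m bc del: index_mult_mat_vec)
      (rule sum.swap)
  finally have eq: "(Q_mat S p s *\<^sub>v u) $ i = (cmat (block_Q0 S p) *\<^sub>v u) $ i
      + (\<Sum>k=1..num_delays S. ?e (tau S k) * (cmat (block_A S k) *\<^sub>v u) $ i)
      + ?e (tau_u S) * (cmat (block_u S p) *\<^sub>v u) $ i" .
  show ?thesis
    unfolding eq distrib_left sum_distrib_left
    using mult_re_part_nth[OF _ u i] bc
    by (simp add: mult.assoc del: index_mult_mat_vec times_complex.sel)
qed

lemma Re_R_mat_mult: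
  assumes wf: "wf_data S p" and u: "u \<in> carrier_vec (dim_state S)" and i: "i < dim_state S"
  shows "Re (z * (R_mat S p s *\<^sub>v u) $ i)
    = (block_n S *\<^sub>v re_part (z * exp (- s * complex_of_real (tau_n S))) u) $ i
    + (block_u_nc S p *\<^sub>v re_part (z * exp (- s * complex_of_real (tau_u S + tau_nc S))) u) $ i
    + (block_nc S p *\<^sub>v re_part (z * exp (- s * complex_of_real (tau_nc S))) u) $ i"
proof -
  let ?n = "dim_state S" and ?e = "\<lambda>t. exp (- s * complex_of_real t)"
  note bc = block_carrier[OF wf]
  have m: "(cmat A *\<^sub>v u) $ i = (\<Sum>j<?n. complex_of_real (A $$ (i, j)) * u $ j)"
    if "A \<in> carrier_mat ?n ?n" for A
    using that u i by (simp add: scalar_prod_def lessThan_atLeast0)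
  have "(R_mat S p s *\<^sub>v u) $ i = (\<Sum>j<?n. R_mat S p s $$ (i, j) * u $ j)"
    using R_mat_carrier[OF wf, of s] u i by (simp add: scalar_prod_def lessThan_atLeast0)
  also have "\<dots> = ?e (tau_n S) * (cmat (block_n S) *\<^sub>v u) $ i
      + ?e (tau_u S + tau_nc S) * (cmat (block_u_nc S p) *\<^sub>v u) $ i
      + ?e (tau_nc S) * (cmat (block_nc S p) *\<^sub>v u) $ i"
    by (simp add: R_mat_index[OF wf i] distrib_right sum.distrib sum_distrib_left m bc mult.assoc
        del: index_mult_mat_vec of_real_add)
  finally have eq: "(R_mat S p s *\<^sub>v u) $ i = ?e (tau_n S) * (cmat (block_n S) *\<^sub>v u) $ i
      + ?e (tau_u S + tau_nc S) * (cmat (block_u_nc S p) *\<^sub>v u) $ i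
      + ?e (tau_nc S) * (cmat (block_nc S p) *\<^sub>v u) $ i" .
  show ?thesis
    unfolding eq distrib_left
    using mult_re_part_nth[OF _ u i] bc
    by (simp add: mult.assoc del: index_mult_mat_vec times_complex.sel of_real_add)
qed

lemma cis_delay: "cis (\<omega> * t) * exp (- (\<i> * complex_of_real \<omega>) * complex_of_real \<tau>) = cis (\<omega> * (t - \<tau>))"
  by (simp add: cis_conv_exp exp_add[symmetric] algebra_simps)

lemma re_cis_has_derivative:
  "((\<lambda>t. Re (cis (\<omega> * t) * z)) has_real_derivative Re (cis (\<omega> * t) * (\<i> * complex_of_real \<omega> * z)))
     (at t within A)"
  by (auto intro!: derivative_eq_intros simp: algebra_simps)

text \<open>
  A vector in the kernel of the characteristic matrix at \<open>\<i> \<omega>\<close> gives an undamped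
  oscillation, which solves the delay equation for all times, so that its restriction to the past
  serves as the initial segment.
\<close>

lemma harmonic_solution:
  assumes wf: "wf_data S p" and u: "u \<in> carrier_vec (dim_state S)"
    and eig: "(\<i> * complex_of_real \<omega>) \<cdot>\<^sub>v u
      = Q_mat S p (\<i> * complex_of_real \<omega>) *\<^sub>v u
        + complex_of_real l \<cdot>\<^sub>v (R_mat S p (\<i> * complex_of_real \<omega>) *\<^sub>v u)"
  shows "subsystem_solution S p l (\<lambda>_. 0\<^sub>v (dim_w S))
    (\<lambda>t. re_part (cis (\<omega> * t)) (vec_first u (dim_x S))) (\<lambda>t. re_part (cis (\<omega> * t)) (vec_last u (dim_xi S)))"
proof -
  let ?s = "\<i> * complex_of_real \<omega>"
  define n c where "n = dim_x S" and "c = dim_xi S"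
  define ux u\<xi> where "ux = vec_first u n" and "u\<xi> = vec_last u c"
  have uc: "ux \<in> carrier_vec n" "u\<xi> \<in> carrier_vec c" and u_eq: "u = ux @\<^sub>v u\<xi>"
    using u by (auto simp: ux_def u\<xi>_def n_def c_def)
  define x \<xi> where "x t = re_part (cis (\<omega> * t)) ux" and "\<xi> t = re_part (cis (\<omega> * t)) u\<xi>" for t
  have xc: "x t \<in> carrier_vec n" "\<xi> t \<in> carrier_vec c" for t
    using uc by (auto simp: x_def \<xi>_def re_part_def)
  have A: "mat_A S k \<in> carrier_mat n n" if "k \<le> num_delays S" for k
    using wf that unfolding wf_data_def n_def by blast
  have tau0: "tau S 0 = 0" using wf unfolding wf_data_def by blast
  have mc: "mat_Bu S * mat_K S p * mat_Cy S \<in> carrier_mat n n"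
    "mat_Bu S * mat_L S p \<in> carrier_mat n c" "mat_Bun S * mat_Cyn S \<in> carrier_mat n n"
    "mat_Bu S * mat_Kn S p * mat_Cy S \<in> carrier_mat n n" "mat_Fn S p * mat_Cy S \<in> carrier_mat c n"
    "mat_F S p * mat_Cy S \<in> carrier_mat c n" "mat_J S p \<in> carrier_mat c c"
    "mat_Bw S \<in> carrier_mat n (dim_w S)"
    using wf unfolding wf_data_def n_def c_def by auto
  have z: "0\<^sub>m a b \<in> carrier_mat a b" for a b by simp
  \<comment> \<open>The state at an earlier time is the present one with a delay exponential absorbed into the phase.\<close>
  have key: "Re (cis (\<omega> * t) * (?s * u $ i)) = (block_Q0 S p *\<^sub>v re_part (cis (\<omega> * t)) u) $ i
      + (\<Sum>k=1..num_delays S. (block_A S k *\<^sub>v re_part (cis (\<omega> * (t - tau S k))) u) $ i)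
      + (block_u S p *\<^sub>v re_part (cis (\<omega> * (t - tau_u S))) u) $ i
      + l * ((block_n S *\<^sub>v re_part (cis (\<omega> * (t - tau_n S))) u) $ i
        + (block_u_nc S p *\<^sub>v re_part (cis (\<omega> * (t - (tau_u S + tau_nc S)))) u) $ i
        + (block_nc S p *\<^sub>v re_part (cis (\<omega> * (t - tau_nc S))) u) $ i)"
    if i: "i < dim_state S" for i t
  proof -
    have "?s * u $ i = (?s \<cdot>\<^sub>v u) $ i" using u i by simp
    also have "\<dots> = (Q_mat S p ?s *\<^sub>v u) $ i + complex_of_real l * (R_mat S p ?s *\<^sub>v u) $ i"
      unfolding eig using Q_mat_carrier[OF wf, of ?s] R_mat_carrier[OF wf, of ?s] i
      by (simp del: index_mult_mat_vec)
    finally have "Re (cis (\<omega> * t) * (?s * u $ i)) = Re (cis (\<omega> * t) * (Q_mat S p ?s *\<^sub>v u) $ i)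
        + l * Re (cis (\<omega> * t) * (R_mat S p ?s *\<^sub>v u) $ i)"
      by (simp add: algebra_simps del: index_mult_mat_vec)
    then show ?thesis
      unfolding Re_Q_mat_mult[OF wf u i] Re_R_mat_mult[OF wf u i] cis_delay .
  qed
  have rhs_x: "subsystem_rhs_x S p l (\<lambda>_. 0\<^sub>v (dim_w S)) x \<xi> t $ i = Re (cis (\<omega> * t) * (?s * ux $ i))"
    if i: "i < n" for i t
  proof -
    have ui: "u $ i = ux $ i" unfolding u_eq using uc i by simp
    have i': "i < dim_state S" using i by (simp add: n_def)
    have "mat_Bw S *\<^sub>v 0\<^sub>v (dim_w S) = 0\<^sub>v n" using mc(8) by auto
    then have "subsystem_rhs_x S p l (\<lambda>_. 0\<^sub>v (dim_w S)) x \<xi> t $ i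
        = (\<Sum>k=0..num_delays S. (mat_A S k *\<^sub>v x (t - tau S k)) $ i)
          + ((mat_Bu S * mat_K S p * mat_Cy S) *\<^sub>v x (t - tau_u S)) $ i
          + l * ((mat_Bun S * mat_Cyn S) *\<^sub>v x (t - tau_n S)) $ i
          + l * ((mat_Bu S * mat_Kn S p * mat_Cy S) *\<^sub>v x (t - (tau_u S + tau_nc S))) $ i
          + ((mat_Bu S * mat_L S p) *\<^sub>v \<xi> (t - tau_u S)) $ i"
      unfolding subsystem_rhs_x_def vec_sum_def using mc i carrier_matD(1)[OF mc(1)]
        carrier_matD(1)[OF mc(2)] carrier_matD(1)[OF mc(3)] carrier_matD(1)[OF mc(4)]
      by (simp add: n_def diff_diff_eq del: index_mult_mat_vec index_mult_mat)
    also have "\<dots> = Re (cis (\<omega> * t) * (?s * u $ i))"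
      unfolding key[OF i'] unfolding block_Q0_def block_A_def block_u_def block_n_def block_u_nc_def block_nc_def
        n_def[symmetric] c_def[symmetric] u_eq
      using four_block_mult_re_part_nth(1)[OF _ _ _ _ uc i] A mc z xc i
      by (simp add: sum.atLeast_Suc_atMost tau0 uc flip: x_def \<xi>_def
          del: index_mult_mat_vec index_mult_mat times_complex.sel) (simp add: distrib_left)
    finally show ?thesis unfolding ui .
  qed
  have rhs_xi: "subsystem_rhs_xi S p l x \<xi> t $ i = Re (cis (\<omega> * t) * (?s * u\<xi> $ i))"
    if i: "i < c" for i t
  proof -
    have z0: "(0\<^sub>m c n *\<^sub>v x r) $ i = 0" "(0\<^sub>m c c *\<^sub>v \<xi> r) $ i = 0" for r
      using i xc by auto
    have ui: "u $ (n + i) = u\<xi> $ i" unfolding u_eq using uc i by simp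
    have i': "n + i < dim_state S" using i by (simp add: n_def c_def)
    have "subsystem_rhs_xi S p l x \<xi> t $ i = (mat_J S p *\<^sub>v \<xi> t) $ i
        + ((mat_F S p * mat_Cy S) *\<^sub>v x t) $ i + l * ((mat_Fn S p * mat_Cy S) *\<^sub>v x (t - tau_nc S)) $ i"
      unfolding subsystem_rhs_xi_def using i carrier_matD(1)[OF mc(5)] carrier_matD(1)[OF mc(6)]
        carrier_matD(1)[OF mc(7)]
      by (simp del: index_mult_mat_vec index_mult_mat)
    also have "\<dots> = Re (cis (\<omega> * t) * (?s * u $ (n + i)))"
      unfolding key[OF i'] unfolding block_Q0_def block_A_def block_u_def block_n_def block_u_nc_def block_nc_def
        n_def[symmetric] c_def[symmetric] u_eq
      using four_block_mult_re_part_nth(2)[OF _ _ _ _ uc i] A mc z xc i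
      by (simp add: uc z0 flip: x_def \<xi>_def
          del: index_mult_mat_vec index_mult_mat times_complex.sel)
    finally show ?thesis unfolding ui .
  qed
  have xn: "x t $ i = Re (cis (\<omega> * t) * ux $ i)" if "i < n" for t i
    using that uc by (simp add: x_def re_part_def)
  have \<xi>n: "\<xi> t $ i = Re (cis (\<omega> * t) * u\<xi> $ i)" if "i < c" for t i
    using that uc by (simp add: \<xi>_def re_part_def)
  have "subsystem_solution S p l (\<lambda>_. 0\<^sub>v (dim_w S)) x \<xi>"
    unfolding subsystem_solution_def n_def[symmetric] c_def[symmetric]
  proof (intro conjI allI impI)
    show "x t \<in> carrier_vec n" "\<xi> t \<in> carrier_vec c" for t by (rule xc)+
    show "continuous_on {- tau_max S..} (\<lambda>t. x t $ i)" if "i < n" for i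
      using that by (simp add: xn) (intro continuous_intros)
    show "continuous_on {- tau_max S..} (\<lambda>t. \<xi> t $ i)" if "i < c" for i
      using that by (simp add: \<xi>n) (intro continuous_intros)
    show "((\<lambda>s. x s $ i) has_real_derivative subsystem_rhs_x S p l (\<lambda>_. 0\<^sub>v (dim_w S)) x \<xi> t $ i)
        (at t within {0..})" if "i < n" for t i
      unfolding rhs_x[OF that] xn[OF that] by (rule re_cis_has_derivative)
    show "((\<lambda>s. \<xi> s $ i) has_real_derivative subsystem_rhs_xi S p l x \<xi> t $ i) (at t within {0..})"
      if "i < c" for t i
      unfolding rhs_xi[OF that] \<xi>n[OF that] by (rule re_cis_has_derivative)
  qed
  then show ?thesis unfolding x_def \<xi>_def ux_def u\<xi>_def n_def c_def .
qed

lemma abs_nth_le_euclid_norm: "i < dim_vec v \<Longrightarrow> \<bar>v $ i\<bar> \<le> euclid_norm v"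
proof -
  assume i: "i < dim_vec v"
  have "(v $ i)\<^sup>2 \<le> (\<Sum>j\<in>{0..<dim_vec v}. (v $ j)\<^sup>2)"
    by (rule member_le_sum) (use i in auto)
  then have "sqrt ((v $ i)\<^sup>2) \<le> euclid_norm v"
    unfolding euclid_norm_def scalar_prod_def by (intro real_sqrt_le_mono) (simp add: power2_eq_square)
  then show ?thesis by simp
qed

text \<open>
  Otherwise \<open>cos (2 \<omega> t) = 2 (cos (\<omega> t))\<^sup>2 - 1\<close> would tend both to \<open>0\<close>
  and to \<open>-1\<close>.
\<close>

lemma cos_not_tendsto_0: "\<not> ((\<lambda>t. cos (\<omega> * t)) \<longlongrightarrow> 0) (at_top :: real filter)"
proof
  assume lim: "((\<lambda>t. cos (\<omega> * t)) \<longlongrightarrow> 0) (at_top :: real filter)"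
  have "filterlim (\<lambda>t::real. 2 * t) at_top at_top"
    by (rule filterlim_tendsto_pos_mult_at_top[OF tendsto_const _ filterlim_ident]) simp
  from filterlim_compose[OF lim this]
  have "((\<lambda>t. cos (2 * (\<omega> * t))) \<longlongrightarrow> 0) (at_top :: real filter)" by (simp add: algebra_simps)
  moreover have "((\<lambda>t. 2 * (cos (\<omega> * t))\<^sup>2 - 1) \<longlongrightarrow> 2 * 0\<^sup>2 - 1) (at_top :: real filter)"
    by (intro tendsto_intros lim)
  ultimately have "(0::real) = 2 * 0\<^sup>2 - 1"
    unfolding cos_double_cos by (intro tendsto_unique[OF trivial_limit_at_top_linorder])
  then show False by simp
qed

text \<open>
  A characteristic root on the imaginary axis would give a solution that oscillates forever,
  against the exponential bound.
\<close>

theorem exp_stable_imp_nonsingular: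
  assumes wf: "wf_data S p" and stable: "subsystem_exp_stable S p l"
  shows "det ((\<i> * complex_of_real \<omega>) \<cdot>\<^sub>m 1\<^sub>m (dim_state S) - Q_mat S p (\<i> * complex_of_real \<omega>)
    - complex_of_real l \<cdot>\<^sub>m R_mat S p (\<i> * complex_of_real \<omega>)) \<noteq> 0" (is "det ?M \<noteq> 0")
proof
  let ?s = "\<i> * complex_of_real \<omega>" and ?n = "dim_state S"
  note Q = Q_mat_carrier[OF wf, of ?s] and R = R_mat_carrier[OF wf, of ?s]
  have M: "?M \<in> carrier_mat ?n ?n" using Q R by auto
  assume "det ?M = 0"
  then obtain v where v: "v \<in> carrier_vec ?n" "v \<noteq> 0\<^sub>v ?n" and Mv: "?M *\<^sub>v v = 0\<^sub>v ?n"
    using det_0_iff_vec_prod_zero[OF M] by blast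
  then obtain j where j: "j < ?n" "v $ j \<noteq> 0" by (metis carrier_vecD eq_vecI index_zero_vec)
  \<comment> \<open>Normalised so that component \<open>j\<close> of the oscillation is exactly a cosine.\<close>
  define u where "u = (1 / v $ j) \<cdot>\<^sub>v v"
  have u: "u \<in> carrier_vec ?n" and uj: "u $ j = 1" using v j by (auto simp: u_def)
  have "?M *\<^sub>v u = 0\<^sub>v ?n"
    unfolding u_def mult_mat_vec[OF M v(1)] Mv by auto
  moreover have "?M *\<^sub>v u = ?s \<cdot>\<^sub>v u - Q_mat S p ?s *\<^sub>v u - complex_of_real l \<cdot>\<^sub>v (R_mat S p ?s *\<^sub>v u)"
  proof -
    have sm: "(c \<cdot>\<^sub>m A) *\<^sub>v u = c \<cdot>\<^sub>v (A *\<^sub>v u)" if "A \<in> carrier_mat ?n ?n" for A :: "complex mat" and c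
      using that u by (auto intro!: eq_vecI)
    have c: "?s \<cdot>\<^sub>m 1\<^sub>m ?n \<in> carrier_mat ?n ?n"
      "?s \<cdot>\<^sub>m 1\<^sub>m ?n - Q_mat S p ?s \<in> carrier_mat ?n ?n"
      "complex_of_real l \<cdot>\<^sub>m R_mat S p ?s \<in> carrier_mat ?n ?n" using Q R by auto
    show ?thesis
      unfolding minus_mult_distrib_mat_vec[OF c(2,3) u] minus_mult_distrib_mat_vec[OF c(1) Q u]
        sm[OF R] sm[OF one_carrier_mat] one_mult_mat_vec[OF u] ..
  qed
  ultimately have eq: "?s \<cdot>\<^sub>v u - Q_mat S p ?s *\<^sub>v u - complex_of_real l \<cdot>\<^sub>v (R_mat S p ?s *\<^sub>v u) = 0\<^sub>v ?n"
    by simp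
  have eig: "?s \<cdot>\<^sub>v u = Q_mat S p ?s *\<^sub>v u + complex_of_real l \<cdot>\<^sub>v (R_mat S p ?s *\<^sub>v u)"
  proof (rule eq_vecI)
    fix i assume "i < dim_vec (Q_mat S p ?s *\<^sub>v u + complex_of_real l \<cdot>\<^sub>v (R_mat S p ?s *\<^sub>v u))"
    then have i: "i < ?n" using R by simp
    then show "(?s \<cdot>\<^sub>v u) $ i = (Q_mat S p ?s *\<^sub>v u + complex_of_real l \<cdot>\<^sub>v (R_mat S p ?s *\<^sub>v u)) $ i"
      using arg_cong[OF eq, of "\<lambda>v. v $ i"] Q R u
      by (simp add: algebra_simps del: index_mult_mat_vec)
  qed (use u R in auto)
  let ?x = "\<lambda>t. re_part (cis (\<omega> * t)) (vec_first u (dim_x S))"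
  let ?xi = "\<lambda>t. re_part (cis (\<omega> * t)) (vec_last u (dim_xi S))"
  have app: "?x t @\<^sub>v ?xi t = re_part (cis (\<omega> * t)) u" for t
    using u by (simp flip: re_part_append)
  have lower: "\<bar>cos (\<omega> * t)\<bar> \<le> euclid_norm (?x t @\<^sub>v ?xi t)" for t
    using abs_nth_le_euclid_norm[of j "re_part (cis (\<omega> * t)) u"] u j uj
    unfolding app by (simp add: re_part_def)
  from stable harmonic_solution[OF wf u eig] obtain c \<gamma> where "\<gamma> > 0"
    and bound: "\<And>t. t \<ge> 0 \<Longrightarrow> euclid_norm (?x t @\<^sub>v ?xi t)
      \<le> c * exp (- \<gamma> * t) * (SUP \<theta>\<in>{- tau_max S..0}. euclid_norm (?x \<theta> @\<^sub>v ?xi \<theta>))"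
    unfolding subsystem_exp_stable_def by blast
  \<comment> \<open>The supremum over the initial segment is independent of the time, so the bound tends to zero.\<close>
  define B where "B = (SUP \<theta>\<in>{- tau_max S..0}. euclid_norm (?x \<theta> @\<^sub>v ?xi \<theta>))"
  have "((\<lambda>t. c * exp (- \<gamma> * t) * B) \<longlongrightarrow> 0) at_top"
  proof -
    have "filterlim (\<lambda>t. \<gamma> * t) at_top at_top"
      by (rule filterlim_tendsto_pos_mult_at_top[OF tendsto_const \<open>\<gamma> > 0\<close> filterlim_ident])
    then have "((\<lambda>t. exp (- \<gamma> * t)) \<longlongrightarrow> 0) at_top"
      by (intro filterlim_compose[OF exp_at_bot]) (simp add: filterlim_uminus_at_bot)
    from tendsto_mult_left_zero[OF tendsto_mult_right_zero[OF this, of c], of B] show ?thesis .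
  qed
  note upper = this
  have ev: "eventually (\<lambda>t. \<bar>cos (\<omega> * t)\<bar> \<le> c * exp (- \<gamma> * t) * B) at_top"
    using eventually_ge_at_top[of 0]
    by eventually_elim (unfold B_def, rule order_trans[OF lower bound])
  have "((\<lambda>t. \<bar>cos (\<omega> * t)\<bar>) \<longlongrightarrow> 0) at_top"
    by (rule tendsto_sandwich[OF _ ev tendsto_const upper]) simp
  from cos_not_tendsto_0 tendsto_rabs_zero_cancel[OF this] show False by (rule notE)
qed

section \<open>Norms of the subsystem and of the network\<close>

lemma C_ext_carrier: "wf_data S p \<Longrightarrow> C_ext S \<in> carrier_mat (dim_z S) (dim_state S)"
  unfolding C_ext_def wf_data_def by auto

lemma B_ext_carrier: "wf_data S p \<Longrightarrow> B_ext S \<in> carrier_mat (dim_state S) (dim_w S)"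
  unfolding B_ext_def wf_data_def by auto

lemma scalar_mat_kron: "scalar_mat d \<otimes>\<^sub>k A = d \<cdot>\<^sub>m A"
  by (rule eq_matI) (auto simp: kron_index)

lemma one_kron: "1\<^sub>m 1 \<otimes>\<^sub>k A = (A :: complex mat)"
  by (rule eq_matI) (auto simp: kron_index)

abbreviation subsystem_pencil :: "'p network_data \<Rightarrow> 'p \<Rightarrow> real \<Rightarrow> complex \<Rightarrow> complex mat" where
  "subsystem_pencil S p l s \<equiv>
     s \<cdot>\<^sub>m 1\<^sub>m (dim_state S) - Q_mat S p s - complex_of_real l \<cdot>\<^sub>m R_mat S p s"

lemma subsystem_pencil_closed_loop:
  assumes "wf_data S p"
  shows "closed_loop (Q_mat S p s) (R_mat S p s) s 1 (scalar_mat (complex_of_real l)) = subsystem_pencil S p l s"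
  unfolding closed_loop_def one_kron scalar_mat_kron using Q_mat_carrier[OF assms, of s] by simp

lemma subsystem_transfer_coupled:
  assumes "wf_data S p"
  shows "subsystem_transfer S p l s
    = coupled_transfer (C_ext S) (B_ext S) (Q_mat S p s) (R_mat S p s) s 1 (scalar_mat (complex_of_real l))"
  unfolding coupled_transfer_def subsystem_pencil_closed_loop[OF assms] one_kron subsystem_transfer_def ..

lemma network_transfer_coupled:
  assumes "wf_data S p"
  shows "network_transfer S p N P s
    = coupled_transfer (C_ext S) (B_ext S) (Q_mat S p s) (R_mat S p s) s N (cmat P)"
  unfolding coupled_transfer_def closed_loop_def network_transfer_def
  using Q_mat_carrier[OF assms, of s] by simp

lemma pencil_carrier: "wf_data S p \<Longrightarrow> subsystem_pencil S p l s \<in> carrier_mat (dim_state S) (dim_state S)"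
  using Q_mat_carrier[of S p s] R_mat_carrier[of S p s] by auto

lemma continuous_pencil:
  assumes wf: "wf_data S p"
  shows "entrywise_continuous_on X (dim_state S) (dim_state S)
    (\<lambda>x. subsystem_pencil S p (fst x) (\<i> * complex_of_real (snd x)))"
  unfolding entrywise_continuous_on_def
proof (intro conjI ballI allI impI)
  fix i j assume i: "i < dim_state S" and j: "j < dim_state S"
  have "subsystem_pencil S p (fst x) (\<i> * complex_of_real (snd x)) $$ (i, j)
      = \<i> * complex_of_real (snd x) * 1\<^sub>m (dim_state S) $$ (i, j)
        - Q_mat S p (\<i> * complex_of_real (snd x)) $$ (i, j)
        - complex_of_real (fst x) * R_mat S p (\<i> * complex_of_real (snd x)) $$ (i, j)" for x
    using Q_mat_carrier[OF wf, of "\<i> * complex_of_real (snd x)"]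
      R_mat_carrier[OF wf, of "\<i> * complex_of_real (snd x)"] i j by simp
  then show "continuous_on X (\<lambda>x. subsystem_pencil S p (fst x) (\<i> * complex_of_real (snd x)) $$ (i, j))"
    unfolding Q_mat_index[OF wf i j] R_mat_index[OF wf i j] by (simp only:) (intro continuous_intros)
qed (rule pencil_carrier[OF wf])

text \<open>
  On the imaginary axis all delay exponentials have modulus one, so that \<open>Q\<close> and \<open>R\<close> are bounded
  uniformly in the frequency.
\<close>

lemma pencil_coefficients_bounded:
  assumes wf: "wf_data S p"
  shows "\<exists>K. \<forall>l\<in>{a..b}. \<forall>w. entry_sum (Q_mat S p (\<i> * complex_of_real w)
    + complex_of_real l \<cdot>\<^sub>m R_mat S p (\<i> * complex_of_real w)) \<le> K"
proof -
  let ?s = "\<lambda>w. \<i> * complex_of_real w" and ?n = "dim_state S"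
  define q where "q i j = \<bar>block_Q0 S p $$ (i, j)\<bar> + (\<Sum>k=1..num_delays S. \<bar>block_A S k $$ (i, j)\<bar>)
    + \<bar>block_u S p $$ (i, j)\<bar>" for i j
  define r where "r i j = \<bar>block_n S $$ (i, j)\<bar> + \<bar>block_u_nc S p $$ (i, j)\<bar> + \<bar>block_nc S p $$ (i, j)\<bar>" for i j
  have e: "norm (exp (- ?s w * complex_of_real t) * complex_of_real c) = \<bar>c\<bar>" for w t c
    by (simp add: norm_mult)
  have "entry_sum (Q_mat S p (?s w) + complex_of_real l \<cdot>\<^sub>m R_mat S p (?s w))
      \<le> (\<Sum>i<?n. \<Sum>j<?n. q i j + max \<bar>a\<bar> \<bar>b\<bar> * r i j)" if l: "l \<in> {a..b}" for l w
  proof -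
    note Q = Q_mat_carrier[OF wf, of "?s w"] and R = R_mat_carrier[OF wf, of "?s w"]
    have "norm ((Q_mat S p (?s w) + complex_of_real l \<cdot>\<^sub>m R_mat S p (?s w)) $$ (i, j))
        \<le> q i j + max \<bar>a\<bar> \<bar>b\<bar> * r i j" if i: "i < ?n" and j: "j < ?n" for i j
    proof -
      have "norm (Q_mat S p (?s w) $$ (i, j)) \<le> q i j"
        unfolding Q_mat_index[OF wf i j] q_def
        by (intro norm_triangle_le add_mono sum_norm_le) (simp_all only: e norm_of_real order_refl)
      moreover have "norm (R_mat S p (?s w) $$ (i, j)) \<le> r i j"
        unfolding R_mat_index[OF wf i j] r_def
        by (intro norm_triangle_le add_mono) (simp_all only: e order_refl)
      moreover have "\<bar>l\<bar> \<le> max \<bar>a\<bar> \<bar>b\<bar>" using l by auto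
      moreover have "(Q_mat S p (?s w) + complex_of_real l \<cdot>\<^sub>m R_mat S p (?s w)) $$ (i, j)
          = Q_mat S p (?s w) $$ (i, j) + complex_of_real l * R_mat S p (?s w) $$ (i, j)"
        using Q R i j by simp
      ultimately show ?thesis
        by (auto intro!: norm_triangle_le add_mono mult_mono simp: norm_mult)
    qed
    then have "(\<Sum>i<?n. \<Sum>j<?n. norm ((Q_mat S p (?s w) + complex_of_real l \<cdot>\<^sub>m R_mat S p (?s w)) $$ (i, j)))
        \<le> (\<Sum>i<?n. \<Sum>j<?n. q i j + max \<bar>a\<bar> \<bar>b\<bar> * r i j)"
      by (intro sum_mono) simp
    then show ?thesis unfolding entry_sum_def using R by simp
  qed
  then show ?thesis by blast
qed

definition gain :: "'p network_data \<Rightarrow> 'p \<Rightarrow> real \<times> real \<Rightarrow> real" where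
  "gain S p x = sigma1 (subsystem_transfer S p (fst x) (\<i> * complex_of_real (snd x)))"

text \<open>
  From here on, the parametrized subsystem is exponentially stable for all parameters in \<open>[a, b]\<close>.
\<close>

context
  fixes S :: "'p network_data" and p :: 'p and a b :: real
  assumes wf: "wf_data S p" and ab: "a \<le> b"
    and stable: "\<And>l. l \<in> {a..b} \<Longrightarrow> subsystem_exp_stable S p l"
begin

lemma dim_w_pos: "dim_w S \<ge> 1" using wf unfolding wf_data_def by blast

lemma pencil_nonsingular:
  "l \<in> {a..b} \<Longrightarrow> det (subsystem_pencil S p l (\<i> * complex_of_real w)) \<noteq> 0"
  by (rule exp_stable_imp_nonsingular[OF wf stable])

lemma subsystem_transfer_carrier:
  assumes "l \<in> {a..b}"
  shows "subsystem_transfer S p l (\<i> * complex_of_real w) \<in> carrier_mat (dim_z S) (dim_w S)"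
  unfolding subsystem_transfer_def
  by (rule mult_carrier_mat[OF mult_carrier_mat[OF C_ext_carrier[OF wf]
        mat_inv_carrier[OF pencil_carrier[OF wf] pencil_nonsingular[OF assms]]] B_ext_carrier[OF wf]])

lemma gain_continuous: "continuous_on ({a..b} \<times> {0..}) (gain S p)"
  unfolding gain_def subsystem_transfer_def
proof (rule continuous_on_sigma1[OF _ dim_w_pos])
  have "entrywise_continuous_on ({a..b} \<times> {0..}) (dim_state S) (dim_state S)
      (\<lambda>x. mat_inv (subsystem_pencil S p (fst x) (\<i> * complex_of_real (snd x))))"
    by (rule entrywise_continuous_on_mat_inv[OF continuous_pencil[OF wf]], rule pencil_nonsingular) auto
  from entrywise_continuous_on_mult[OF entrywise_continuous_on_mult[OF
        entrywise_continuous_on_const[OF C_ext_carrier[OF wf]] this]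
      entrywise_continuous_on_const[OF B_ext_carrier[OF wf]]]
  show "entrywise_continuous_on ({a..b} \<times> {0..}) (dim_z S) (dim_w S)
      (\<lambda>x. C_ext S * mat_inv (subsystem_pencil S p (fst x) (\<i> * complex_of_real (snd x))) * B_ext S)" .
qed

lemma gain_nonneg: "l \<in> {a..b} \<Longrightarrow> 0 \<le> gain S p (l, w)"
  unfolding gain_def using sigma1_largest_gain(1)[OF subsystem_transfer_carrier dim_w_pos] by simp

text \<open>
  If \<open>y\<close> is the state response to the input \<open>v\<close>, then \<open>\<i> w y = B v + (Q + l R) y\<close>, hence
  \<open>(w - K) vnorm y\<close> is bounded by a multiple of \<open>vnorm v\<close>.
\<close>

lemma gain_le_inverse_frequency:
  assumes l: "l \<in> {a..b}" and w: "w > K"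
    and K: "entry_sum (Q_mat S p (\<i> * complex_of_real w) + complex_of_real l \<cdot>\<^sub>m R_mat S p (\<i> * complex_of_real w)) \<le> K"
  shows "gain S p (l, w) \<le> entry_sum (C_ext S) * entry_sum (B_ext S) / (w - K)"
proof -
  let ?s = "\<i> * complex_of_real w" and ?n = "dim_state S"
  let ?M = "subsystem_pencil S p l ?s" and ?X = "Q_mat S p ?s + complex_of_real l \<cdot>\<^sub>m R_mat S p ?s"
  note C = C_ext_carrier[OF wf] and B = B_ext_carrier[OF wf]
  note Q = Q_mat_carrier[OF wf, of ?s] and R = R_mat_carrier[OF wf, of ?s]
  note M = pencil_carrier[OF wf, where l = l and s = ?s]
  note I = mat_inv[OF M pencil_nonsingular[OF l]]
  have X: "?X \<in> carrier_mat ?n ?n" using R by simp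
  have K0: "0 \<le> K" by (rule order_trans[OF entry_sum_nonneg K])
  have "sigma1 (subsystem_transfer S p l ?s) \<le> entry_sum (C_ext S) * entry_sum (B_ext S) / (w - K)"
  proof (rule sigma1_le_if_gain[OF subsystem_transfer_carrier[OF l] dim_w_pos])
    fix v :: "complex vec" assume v: "v \<in> carrier_vec (dim_w S)"
    define g where "g = B_ext S *\<^sub>v v"
    define y where "y = mat_inv ?M *\<^sub>v g"
    have g: "g \<in> carrier_vec ?n" using B v by (simp add: g_def)
    have y: "y \<in> carrier_vec ?n" unfolding y_def by (rule mult_mat_vec_carrier[OF I(1) g])
    have T: "subsystem_transfer S p l ?s *\<^sub>v v = C_ext S *\<^sub>v y"
      unfolding subsystem_transfer_def y_def g_def
      by (subst assoc_mult_mat_vec[OF mult_carrier_mat[OF C I(1)] B v])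
        (rule assoc_mult_mat_vec[OF C I(1) g[unfolded g_def]])
    have I1: "?s \<cdot>\<^sub>m 1\<^sub>m ?n \<in> carrier_mat ?n ?n" by simp
    have "g = ?M *\<^sub>v y"
      unfolding y_def assoc_mult_mat_vec[OF M I(1) g, symmetric] I(2) using g by simp
    also have "?M = ?s \<cdot>\<^sub>m 1\<^sub>m ?n - ?X"
      using Q R by (intro eq_matI) auto
    also have "\<dots> *\<^sub>v y = (?s \<cdot>\<^sub>m 1\<^sub>m ?n) *\<^sub>v y - ?X *\<^sub>v y"
      by (rule minus_mult_distrib_mat_vec[OF I1 X y])
    also have "(?s \<cdot>\<^sub>m 1\<^sub>m ?n) *\<^sub>v y = ?s \<cdot>\<^sub>v y"
      using y by (auto intro!: eq_vecI)
    finally have g_eq: "g = ?s \<cdot>\<^sub>v y - ?X *\<^sub>v y" .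
    have "?s \<cdot>\<^sub>v y = g + ?X *\<^sub>v y"
      unfolding g_eq using y R by (intro eq_vecI) (auto simp del: index_mult_mat_vec)
    moreover have "vnorm (?s \<cdot>\<^sub>v y) = w * vnorm y"
      unfolding vnorm_smult using w K0 by (simp add: norm_mult)
    ultimately have "w * vnorm y = vnorm (g + ?X *\<^sub>v y)"
      by metis
    also have "\<dots> \<le> vnorm g + vnorm (?X *\<^sub>v y)"
      by (rule vnorm_triangle[OF g mult_mat_vec_carrier[OF X y]])
    also have "\<dots> \<le> entry_sum (B_ext S) * vnorm v + K * vnorm y"
    proof (rule add_mono)
      show "vnorm g \<le> entry_sum (B_ext S) * vnorm v"
        unfolding g_def by (rule vnorm_mult_le) (use B v in auto)
      have "vnorm (?X *\<^sub>v y) \<le> entry_sum ?X * vnorm y" by (rule vnorm_mult_le) (use X y in auto)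
      also have "\<dots> \<le> K * vnorm y" by (rule mult_right_mono[OF K vnorm_nonneg])
      finally show "vnorm (?X *\<^sub>v y) \<le> K * vnorm y" .
    qed
    finally have "vnorm y \<le> entry_sum (B_ext S) * vnorm v / (w - K)"
      using w by (simp add: field_simps)
    then have "entry_sum (C_ext S) * vnorm y \<le> entry_sum (C_ext S) * (entry_sum (B_ext S) * vnorm v / (w - K))"
      by (rule mult_left_mono[OF _ entry_sum_nonneg])
    moreover have "vnorm (C_ext S *\<^sub>v y) \<le> entry_sum (C_ext S) * vnorm y"
      by (rule vnorm_mult_le) (use C y in auto)
    ultimately show "vnorm (subsystem_transfer S p l ?s *\<^sub>v v)
        \<le> entry_sum (C_ext S) * entry_sum (B_ext S) / (w - K) * vnorm v"
      unfolding T by simp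
  qed
  then show ?thesis by (simp add: gain_def)
qed

lemma gain_decays:
  assumes "e > 0"
  shows "\<exists>W. \<forall>l\<in>{a..b}. \<forall>w>W. gain S p (l, w) < e"
proof -
  from pencil_coefficients_bounded[OF wf] obtain K where
    K: "\<And>l w. l \<in> {a..b} \<Longrightarrow> entry_sum (Q_mat S p (\<i> * complex_of_real w)
      + complex_of_real l \<cdot>\<^sub>m R_mat S p (\<i> * complex_of_real w)) \<le> K" by blast
  define B where "B = entry_sum (C_ext S) * entry_sum (B_ext S)"
  have B: "B \<ge> 0" by (simp add: B_def entry_sum_nonneg)
  have "gain S p (l, w) < e" if l: "l \<in> {a..b}" and w: "w > K + B / e" for l w
  proof -
    have "B / e < w - K" using w by simp
    moreover have "0 \<le> B / e" using B assms by simp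
    \<comment> \<open>The threshold solves \<open>B / (w - K) = e\<close> for \<open>w\<close>.\<close>
    ultimately have wK: "w > K" by linarith
    from \<open>B / e < w - K\<close> have "B < e * (w - K)" using assms by (simp add: divide_less_eq mult.commute)
    with wK have "B / (w - K) < e" by (simp add: divide_less_eq)
    with gain_le_inverse_frequency[OF l wK K[OF l]] show ?thesis by (simp add: B_def)
  qed
  then show ?thesis by blast
qed

text \<open>
  Used twice: for a single parameter, where it yields the H-infinity norm, and for the whole interval,
  where it yields the robust one.  Maximising jointly over parameter and frequency
  uses the joint continuity of the gain directly, in place of continuity of the norm in the parameter.
\<close>

lemma gain_attains_max:
  assumes "compact L" "L \<noteq> {}" "L \<subseteq> {a..b}"
  shows "\<exists>l\<in>L. \<exists>w\<ge>0. \<forall>l'\<in>L. \<forall>w'\<ge>0. gain S p (l', w') \<le> gain S p (l, w)"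
proof (rule decaying_function_attains_max[OF assms(1,2)])
  show "continuous_on (L \<times> {0..}) (gain S p)"
    by (rule continuous_on_subset[OF gain_continuous]) (use assms(3) in auto)
  show "0 \<le> gain S p (l, w)" if "l \<in> L" for l w using that assms(3) gain_nonneg by blast
  show "\<exists>W. \<forall>l\<in>L. \<forall>w>W. 0 \<le> w \<longrightarrow> gain S p (l, w) < e" if "e > 0" for e
    using gain_decays[OF that] assms(3) by blast
qed

lemma hinf_norm_subsystem:
  assumes l: "l \<in> {a..b}"
  shows "\<exists>w\<ge>0. hinf_norm (subsystem_transfer S p l) = gain S p (l, w)"
    and "w \<ge> 0 \<Longrightarrow> gain S p (l, w) \<le> hinf_norm (subsystem_transfer S p l)"
proof -
  from gain_attains_max[of "{l}"] l obtain w0 where w0: "w0 \<ge> 0"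
    and max: "\<And>w. w \<ge> 0 \<Longrightarrow> gain S p (l, w) \<le> gain S p (l, w0)" by auto
  have "hinf_norm (subsystem_transfer S p l) = gain S p (l, w0)"
    unfolding hinf_norm_def by (rule Greatest_equality) (use w0 max in \<open>auto simp: gain_def\<close>)
  with w0 max show "\<exists>w\<ge>0. hinf_norm (subsystem_transfer S p l) = gain S p (l, w)"
    "w \<ge> 0 \<Longrightarrow> gain S p (l, w) \<le> hinf_norm (subsystem_transfer S p l)" by auto
qed

lemma robust_hinf_norm_subsystem:
  shows "\<exists>l\<in>{a..b}. \<exists>w\<ge>0. robust_hinf_norm (subsystem_transfer S p) a b = gain S p (l, w)"
    and "l \<in> {a..b} \<Longrightarrow> hinf_norm (subsystem_transfer S p l) \<le> robust_hinf_norm (subsystem_transfer S p) a b"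
proof -
  from gain_attains_max[of "{a..b}"] ab obtain l0 w0 where l0: "l0 \<in> {a..b}" and w0: "w0 \<ge> 0"
    and max: "\<And>l w. l \<in> {a..b} \<Longrightarrow> w \<ge> 0 \<Longrightarrow> gain S p (l, w) \<le> gain S p (l0, w0)" by auto
  have le: "hinf_norm (subsystem_transfer S p l) \<le> gain S p (l0, w0)" if "l \<in> {a..b}" for l
    using hinf_norm_subsystem(1)[OF that] max[OF that] by auto
  have eq: "hinf_norm (subsystem_transfer S p l0) = gain S p (l0, w0)"
    using le[OF l0] hinf_norm_subsystem(2)[OF l0 w0] by simp
  have "robust_hinf_norm (subsystem_transfer S p) a b = gain S p (l0, w0)"
    unfolding robust_hinf_norm_def
    by (rule Greatest_equality) (use l0 eq le in \<open>auto simp flip: eq\<close>)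
  with l0 w0 le show "\<exists>l\<in>{a..b}. \<exists>w\<ge>0. robust_hinf_norm (subsystem_transfer S p) a b = gain S p (l, w)"
    "l \<in> {a..b} \<Longrightarrow> hinf_norm (subsystem_transfer S p l) \<le> robust_hinf_norm (subsystem_transfer S p) a b"
    by auto
qed

text \<open>
  The entries of the unitary diagonal form list the spectrum of the adjacency matrix with
  multiplicities, which a union of sets does not see.
\<close>

lemma network_singular_values:
  assumes adm: "admissible_adjacency a b N P"
  shows "singular_values (network_transfer S p N P (\<i> * complex_of_real w))
    = (\<Union>l\<in>{l. complex_of_real l \<in> spectrum (cmat P)}. singular_values (subsystem_transfer S p l (\<i> * complex_of_real w)))"
proof -
  let ?s = "\<i> * complex_of_real w"
  from adm have P: "cmat P \<in> carrier_mat N N" and spec: "spectrum (cmat P) \<subseteq> complex_of_real ` {a..b}"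
    and "unitarily_diagonalizable (cmat P)" unfolding admissible_adjacency_def by auto
  then obtain U D where diag: "diagonal_mat D" and sim: "similar_mat_wit (cmat P) D U (mat_adjoint U)"
    unfolding unitarily_diagonalizable_def by blast
  let ?V = "mat_adjoint U"
  from sim P have U: "U \<in> carrier_mat N N" and D: "D \<in> carrier_mat N N" and V: "?V \<in> carrier_mat N N"
    and UV: "U * ?V = 1\<^sub>m N" and VU: "?V * U = 1\<^sub>m N" and PD: "cmat P = U * D * ?V"
    unfolding similar_mat_wit_def Let_def carrier_matD(1)[OF P] insert_subset by - (elim conjE, assumption)+
  have "cmat P * U = (U * D) * (?V * U)"
    unfolding PD by (rule assoc_mult_mat[OF mult_carrier_mat[OF U D] V U])
  then have PU: "cmat P * U = U * D" using VU right_mult_one_mat[OF mult_carrier_mat[OF U D]] by simp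
  have "?V * cmat P = (?V * U) * (D * ?V)"
    unfolding PD assoc_mult_mat[OF U D V] by (rule assoc_mult_mat[OF V U mult_carrier_mat[OF D V], symmetric])
  then have VP: "?V * cmat P = D * ?V" using VU left_mult_one_mat[OF mult_carrier_mat[OF D V]] by simp
  have "similar_mat (cmat P) D" using sim unfolding similar_mat_def by blast
  moreover have "upper_triangular D"
    using diag D unfolding diagonal_mat_def upper_triangular_def by auto
  ultimately have cp: "char_poly (cmat P) = (\<Prod>d\<leftarrow>diag_mat D. [:- d, 1:])"
    using char_poly_similar char_poly_upper_triangular[OF D] by metis
  have spec_eq: "spectrum (cmat P) = (\<lambda>i. D $$ (i, i)) ` {..<N}"
    unfolding spectrum_root_char_poly[OF P] cp using D
    by (auto simp: poly_prod_list prod_list_zero_iff diag_mat_def)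
  define d where "d i = Re (D $$ (i, i))" for i
  have d: "complex_of_real (d i) = D $$ (i, i)" and dab: "d i \<in> {a..b}" if "i < N" for i
  proof -
    have "D $$ (i, i) \<in> complex_of_real ` {a..b}" using that spec spec_eq by blast
    then show "complex_of_real (d i) = D $$ (i, i)" "d i \<in> {a..b}" by (auto simp: d_def)
  qed
  have "singular_values (network_transfer S p N P ?s)
      = (\<Union>i<N. singular_values (coupled_transfer (C_ext S) (B_ext S) (Q_mat S p ?s) (R_mat S p ?s) ?s 1
          (scalar_mat (D $$ (i, i)))))"
    unfolding network_transfer_coupled[OF wf]
  proof (rule singular_values_coupled_transfer[OF Q_mat_carrier[OF wf] R_mat_carrier[OF wf] C_ext_carrier[OF wf]
        B_ext_carrier[OF wf] U D P diag UV VU PU VP])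
    show "det (closed_loop (Q_mat S p ?s) (R_mat S p ?s) ?s 1 (scalar_mat (D $$ (i, i)))) \<noteq> 0" if "i < N" for i
      unfolding d[OF that, symmetric] subsystem_pencil_closed_loop[OF wf] by (rule pencil_nonsingular[OF dab[OF that]])
  qed
  also have "\<dots> = (\<Union>i<N. singular_values (subsystem_transfer S p (d i) ?s))"
    by (intro SUP_cong refl) (simp add: subsystem_transfer_coupled[OF wf] d)
  also have "\<dots> = (\<Union>l\<in>d ` {..<N}. singular_values (subsystem_transfer S p l ?s))" by simp
  also have "d ` {..<N} = {l. complex_of_real l \<in> spectrum (cmat P)}"
    unfolding spec_eq by (auto simp: image_iff d) (metis Re_complex_of_real d_def lessThan_iff)
  finally show ?thesis .
qed

text \<open>
  The H-infinity norm of the network is the largest of those of the subsystems at the eigenvalues of the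
  coupling matrix.  Since these are finitely many and each attains its norm, so does the network.
\<close>

lemma hinf_norm_network:
  assumes N: "N \<ge> 1" and adm: "admissible_adjacency a b N P"
  shows "\<exists>l\<in>{a..b}. hinf_norm (network_transfer S p N P) = hinf_norm (subsystem_transfer S p l)"
    and "\<And>l. complex_of_real l \<in> spectrum (cmat P) \<Longrightarrow>
      hinf_norm (subsystem_transfer S p l) \<le> hinf_norm (network_transfer S p N P)"
proof -
  let ?h = "\<lambda>l. hinf_norm (subsystem_transfer S p l)"
  define \<Lambda> where "\<Lambda> = {l. complex_of_real l \<in> spectrum (cmat P)}"
  from adm have P: "cmat P \<in> carrier_mat N N" and spec: "spectrum (cmat P) \<subseteq> complex_of_real ` {a..b}"
    unfolding admissible_adjacency_def by auto
  have "spectrum (cmat P) = complex_of_real ` \<Lambda>" using spec by (auto simp: \<Lambda>_def)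
  then have fin: "finite \<Lambda>" and ne: "\<Lambda> \<noteq> {}"
    using card_finite_spectrum(1)[OF P] spectrum_non_empty[OF P] N
    by (auto dest: finite_imageD simp: inj_on_def)
  have \<Lambda>ab: "l \<in> {a..b}" if "l \<in> \<Lambda>" for l using that spec by (auto simp: \<Lambda>_def)
  define f where "f w = sigma1 (network_transfer S p N P (\<i> * complex_of_real w))" for w
  have f_eq: "f w = Max (\<Union>l\<in>\<Lambda>. singular_values (subsystem_transfer S p l (\<i> * complex_of_real w)))" for w
    unfolding f_def sigma1_def network_singular_values[OF adm] \<Lambda>_def ..
  have sv: "finite (singular_values (subsystem_transfer S p l (\<i> * complex_of_real w)))"
    "sigma1 (subsystem_transfer S p l (\<i> * complex_of_real w))
      \<in> singular_values (subsystem_transfer S p l (\<i> * complex_of_real w))" if "l \<in> \<Lambda>" for l w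
    using sigma1_largest_gain(4,5)[OF subsystem_transfer_carrier[OF \<Lambda>ab[OF that]] dim_w_pos] .
  have lower: "gain S p (l, w) \<le> f w" if "l \<in> \<Lambda>" for l w
    unfolding f_eq gain_def fst_conv snd_conv using fin sv(1)
    by (intro Max_ge UN_I[OF that] sv(2)[OF that]) auto
  have upper: "\<exists>l\<in>\<Lambda>. f w \<le> gain S p (l, w)" for w
  proof -
    have "f w \<in> (\<Union>l\<in>\<Lambda>. singular_values (subsystem_transfer S p l (\<i> * complex_of_real w)))"
      unfolding f_eq
    proof (rule Max_in)
      show "finite (\<Union>l\<in>\<Lambda>. singular_values (subsystem_transfer S p l (\<i> * complex_of_real w)))"
        using fin sv(1) by blast
      from ne obtain l where "l \<in> \<Lambda>" by blast
      from sv(2)[OF this, of w] this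
      show "(\<Union>l\<in>\<Lambda>. singular_values (subsystem_transfer S p l (\<i> * complex_of_real w))) \<noteq> {}" by blast
    qed
    then obtain l where l: "l \<in> \<Lambda>" "f w \<in> singular_values (subsystem_transfer S p l (\<i> * complex_of_real w))"
      by blast
    then have "f w \<le> gain S p (l, w)" unfolding gain_def sigma1_def using sv(1)[OF l(1)] by simp
    with l show ?thesis by blast
  qed
  \<comment> \<open>A worst eigenvalue; the network attains its norm at the frequency where this mode does.\<close>
  obtain l0 where l0: "l0 \<in> \<Lambda>" and max: "\<And>l. l \<in> \<Lambda> \<Longrightarrow> ?h l \<le> ?h l0"
  proof -
    have "Max (?h ` \<Lambda>) \<in> ?h ` \<Lambda>" using fin ne by (intro Max_in) auto
    then obtain l0 where l0: "l0 \<in> \<Lambda>" "Max (?h ` \<Lambda>) = ?h l0" by blast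
    then have "?h l \<le> ?h l0" if "l \<in> \<Lambda>" for l using Max_ge[of "?h ` \<Lambda>" "?h l"] fin that by auto
    with l0(1) show ?thesis using that by blast
  qed
  have f_le: "f w \<le> ?h l0" if "w \<ge> 0" for w
  proof -
    from upper obtain l where l: "l \<in> \<Lambda>" "f w \<le> gain S p (l, w)" by blast
    then show ?thesis using hinf_norm_subsystem(2)[OF \<Lambda>ab[OF l(1)] that] max[OF l(1)] by linarith
  qed
  from hinf_norm_subsystem(1)[OF \<Lambda>ab[OF l0]] obtain w0 where w0: "w0 \<ge> 0" "?h l0 = gain S p (l0, w0)" by blast
  have f_w0: "f w0 = ?h l0" using f_le[OF w0(1)] lower[OF l0, of w0] w0(2) by simp
  have eq: "hinf_norm (network_transfer S p N P) = ?h l0"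
    unfolding hinf_norm_def[of "network_transfer S p N P"] f_def[symmetric]
  proof (rule Greatest_equality)
    show "?h l0 \<in> f ` {0..}" using f_w0 w0(1) by (metis atLeast_iff image_eqI)
    show "y \<le> ?h l0" if "y \<in> f ` {0..}" for y using that f_le by auto
  qed
  show "\<exists>l\<in>{a..b}. hinf_norm (network_transfer S p N P) = ?h l" using eq \<Lambda>ab[OF l0] by blast
  show "?h l \<le> hinf_norm (network_transfer S p N P)" if "complex_of_real l \<in> spectrum (cmat P)" for l
    using max that unfolding eq \<Lambda>_def by blast
qed

lemma hinf_norm_network_le:
  "N \<ge> 1 \<Longrightarrow> admissible_adjacency a b N P \<Longrightarrow>
    hinf_norm (network_transfer S p N P) \<le> robust_hinf_norm (subsystem_transfer S p) a b"
  using hinf_norm_network(1) robust_hinf_norm_subsystem(2) by metis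

text \<open>
  At the worst parameter and frequency, continuity in the parameter allows replacing the worst
  parameter by a nearby eigenvalue of some network, at an arbitrarily small loss.
\<close>

lemma robust_hinf_norm_le_SUP:
  assumes adm: "\<And>N. N \<ge> 1 \<Longrightarrow> admissible_adjacency a b N (P N)"
    and dense: "complex_of_real ` {a..b} \<subseteq> closure (\<Union>N\<in>{1..}. spectrum (cmat (P N)))"
  shows "ereal (robust_hinf_norm (subsystem_transfer S p) a b)
    \<le> (SUP N\<in>{1..}. ereal (hinf_norm (network_transfer S p N (P N))))"
proof (rule ereal_le_epsilon2)
  fix e :: real assume e: "e > 0"
  let ?\<rho> = "robust_hinf_norm (subsystem_transfer S p) a b"
  from robust_hinf_norm_subsystem(1) obtain l w where l: "l \<in> {a..b}" and w: "w \<ge> 0"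
    and \<rho>: "?\<rho> = gain S p (l, w)" by blast
  have "continuous_on {a..b} (\<lambda>l. gain S p (l, w))"
    by (rule continuous_on_compose2[OF gain_continuous]) (use w in \<open>auto intro!: continuous_intros\<close>)
  with l e obtain \<delta> where \<delta>: "\<delta> > 0"
    and close: "\<And>l'. l' \<in> {a..b} \<Longrightarrow> dist l' l < \<delta> \<Longrightarrow> dist (gain S p (l', w)) (gain S p (l, w)) < e"
    unfolding continuous_on_iff by blast
  from dense l have "complex_of_real l \<in> closure (\<Union>N\<in>{1..}. spectrum (cmat (P N)))" by blast
  with \<delta> obtain \<mu> N where N: "N \<ge> 1" and \<mu>: "\<mu> \<in> spectrum (cmat (P N))" and d: "dist \<mu> (complex_of_real l) < \<delta>"
    unfolding closure_approachable by auto
  from adm[OF N] \<mu> obtain l' where l': "l' \<in> {a..b}" and \<mu>_eq: "\<mu> = complex_of_real l'"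
    unfolding admissible_adjacency_def by blast
  have "?\<rho> - e \<le> gain S p (l', w)"
    using close[OF l'] d unfolding \<mu>_eq \<rho> by (simp add: dist_real_def)
  also have "\<dots> \<le> hinf_norm (subsystem_transfer S p l')" by (rule hinf_norm_subsystem(2)[OF l' w])
  also have "\<dots> \<le> hinf_norm (network_transfer S p N (P N))"
    by (rule hinf_norm_network(2)[OF N adm[OF N]]) (use \<mu> \<mu>_eq in simp)
  finally have "ereal ?\<rho> \<le> ereal (hinf_norm (network_transfer S p N (P N))) + ereal e" by simp
  also have "\<dots> \<le> (SUP N\<in>{1..}. ereal (hinf_norm (network_transfer S p N (P N)))) + ereal e"
    by (intro add_right_mono SUP_upper) (use N in auto)
  finally show "ereal ?\<rho> \<le> (SUP N\<in>{1..}. ereal (hinf_norm (network_transfer S p N (P N)))) + ereal e" .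
qed

end

lemma spectrum_det:
  fixes A :: "complex mat"
  assumes A: "A \<in> carrier_mat n n"
  shows "{\<mu>. det (\<mu> \<cdot>\<^sub>m 1\<^sub>m n - A) = 0} = spectrum A"
proof -
  have "\<mu> \<cdot>\<^sub>m 1\<^sub>m n - A = - char_matrix A \<mu>" for \<mu>
    using A by (intro eq_matI) (auto simp: char_matrix_def)
  then show ?thesis
    unfolding spectrum_def eigenvalue_det[OF A] using det_0_negate[OF char_matrix_closed[OF A]] by auto
qed

text \<open>
  Distances to the empty set are zero by convention, so the second set has to be nonempty.
\<close>

lemma hausdorff_dist_zero_imp_subset_closure:
  assumes "hausdorff_dist X Y = 0" and "Y \<noteq> {}"
  shows "X \<subseteq> closure Y"
proof
  fix x assume "x \<in> X"
  then have "ereal (infdist x Y) \<le> (SUP x\<in>X. ereal (infdist x Y))" by (rule SUP_upper)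
  also have "\<dots> \<le> hausdorff_dist X Y" unfolding hausdorff_dist_def by simp
  finally have "infdist x Y = 0" using assms(1) infdist_nonneg[of x Y] by simp
  then show "x \<in> closure Y" using in_closure_iff_infdist_zero[OF assms(2)] by simp
qed

theorem corollary3:
  fixes S :: "'p network_data" and p :: 'p and a b :: real
  assumes "wf_data S p"
    and "a \<le> b"
    and "\<forall>l\<in>{a..b}. subsystem_exp_stable S p l"
  shows
    "(\<forall>N P. N \<ge> 1 \<longrightarrow> admissible_adjacency a b N P \<longrightarrow>
        hinf_norm (network_transfer S p N P) \<le> robust_hinf_norm (subsystem_transfer S p) a b)
     \<and>
     (\<forall>P :: nat \<Rightarrow> real mat. (\<forall>N\<ge>1. admissible_adjacency a b N (P N)) \<longrightarrow>
        (SUP N\<in>{1..}. ereal (hinf_norm (network_transfer S p N (P N))))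
          \<le> ereal (robust_hinf_norm (subsystem_transfer S p) a b))
     \<and>
     (\<forall>P :: nat \<Rightarrow> real mat. (\<forall>N\<ge>1. admissible_adjacency a b N (P N)) \<longrightarrow>
        hausdorff_dist (complex_of_real ` {a..b})
          (\<Union>N\<in>{1..}. {\<mu>. det (\<mu> \<cdot>\<^sub>m 1\<^sub>m N - cmat (P N)) = 0}) = 0 \<longrightarrow>
        (SUP N\<in>{1..}. ereal (hinf_norm (network_transfer S p N (P N))))
          = ereal (robust_hinf_norm (subsystem_transfer S p) a b))"
proof (intro conjI allI impI)
  have stable: "\<And>l. l \<in> {a..b} \<Longrightarrow> subsystem_exp_stable S p l" using assms(3) by blast
  note le = hinf_norm_network_le[OF assms(1,2) stable]
  show "hinf_norm (network_transfer S p N P) \<le> robust_hinf_norm (subsystem_transfer S p) a b"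
    if "N \<ge> 1" "admissible_adjacency a b N P" for N P using le that by blast
  show SUP_le: "(SUP N\<in>{1..}. ereal (hinf_norm (network_transfer S p N (P N))))
      \<le> ereal (robust_hinf_norm (subsystem_transfer S p) a b)"
    if "\<forall>N\<ge>1. admissible_adjacency a b N (P N)" for P
    using le that by (intro SUP_least) simp
  fix P :: "nat \<Rightarrow> real mat"
  assume adm: "\<forall>N\<ge>1. admissible_adjacency a b N (P N)"
    and "hausdorff_dist (complex_of_real ` {a..b})
      (\<Union>N\<in>{1..}. {\<mu>. det (\<mu> \<cdot>\<^sub>m 1\<^sub>m N - cmat (P N)) = 0}) = 0"
  moreover have "cmat (P N) \<in> carrier_mat N N" if "N \<ge> 1" for N
    using adm that unfolding admissible_adjacency_def by auto
  ultimately have h: "hausdorff_dist (complex_of_real ` {a..b}) (\<Union>N\<in>{1..}. spectrum (cmat (P N))) = 0"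
    and "spectrum (cmat (P 1)) \<noteq> {}"
    using spectrum_det spectrum_non_empty[of "cmat (P 1)" 1] by (auto cong: SUP_cong_simp)
  then have "(\<Union>N\<in>{1..}. spectrum (cmat (P N))) \<noteq> {}" by auto
  from hausdorff_dist_zero_imp_subset_closure[OF h this]
  have "ereal (robust_hinf_norm (subsystem_transfer S p) a b)
      \<le> (SUP N\<in>{1..}. ereal (hinf_norm (network_transfer S p N (P N))))"
    using robust_hinf_norm_le_SUP[OF assms(1,2) stable] adm by blast
  then show "(SUP N\<in>{1..}. ereal (hinf_norm (network_transfer S p N (P N))))
      = ereal (robust_hinf_norm (subsystem_transfer S p) a b)"
    using SUP_le[OF adm] by (rule antisym[rotated])
qed

end
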